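(* Let $\Gamma$ be a biconnected graph such that the flag complex $\Delta_\Gamma$ is simply connected. Then $\Sigma^1(BB_\Gamma)^c$ is a union of missing subspheres corresponding to full separating subgraphs. More precisely: (1) $\Sigma^1(BB_\Gamma)^c=\bigcup_\Lambda S_\Lambda$, where $\Lambda$ ranges over the minimal full separating subgraphs of $\Gamma$. (2) There is a bijection between maximal missing subspheres of $\Sigma^1(BB_\Gamma)^c$ and minimal full separating subgraphs of $\Gamma$.
   Context: All graphs are finite simplicial graphs, and $\Gamma$ is assumed connected. A subgraph $\Lambda\subseteq\Gamma$ is separating if the full subgraph of $\Gamma$ spanned by $V(\Gamma)\setminus V(\Lambda)$ is disconnected. A cut vertex is a vertex that is separating as a subgraph, and a graph is biconnected if it has no cut vertices. A minimal full separating subgraph is a full separating subgraph none of whose proper full subgraphs is separating in $\Gamma$. The flag complex $\Delta_\Gamma$ is the simplicial complex whose simplices are the nonempty sets of pairwise adjacent vertices of $\Gamma$. The right-angled Artin group on $\Gamma$ is $A_\Gamma=\langle V(\Gamma)\mid [v,w] \text{ whenever } (v,w)\in E(\Gamma)\rangle$, and the Bestvina--Brady group $BB_\Gamma$ is the kernel of the homomorphism $A_\Gamma\to\mathbb Z$ sending every vertex generator to $1$. For $\Gamma$ connected, $BB_\Gamma$ is finitely generated by the oriented edges of $\Gamma$, an oriented edge $e$ from $\iota e$ to $\tau e$ being the element $\tau e(\iota e)^{-1}$; whether a character vanishes on an edge does not depend on orientation. For a finitely generated group $G$, the character sphere is $S(G)=\{[\chi]\mid \chi\in\operatorname{Hom}(G,\mathbb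 R)\setminus\{0\}\}$, where $[\chi]$ is the class of $\chi$ up to multiplication by positive reals. For a finite generating set $\mathcal S$, the BNS-invariant $\Sigma^1(G)\subseteq S(G)$ is the set of $[\chi]$ such that the full subgraph of the Cayley graph $\operatorname{Cay}(G,\mathcal S)$ spanned by $\{g\in G\mid\chi(g)\ge 0\}$ is connected (independent of $\mathcal S$), and $\Sigma^1(G)^c=S(G)\setminus\Sigma^1(G)$. A great subsphere is a set $S_W=\{[\chi]\mid\chi\in W\setminus\{0\}\}$ for a linear subspace $W\subseteq\operatorname{Hom}(G,\mathbb R)$; it is a missing subsphere if $S_W\subseteq\Sigma^1(G)^c$. Maximality of missing subspheres is with respect to inclusion. For a subgraph $\Lambda\subseteq\Gamma$, put $W_\Lambda=\{\chi\in\operatorname{Hom}(BB_\Gamma,\mathbb R)\mid\chi(e)=0\ \forall e\in E(\Lambda)\}$ and let $S_\Lambda=\{[\chi]\mid\chi\in W_\Lambda\setminus\{0\}\}$ be the corresponding great subsphere of $S(BB_\Gamma)$.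
   Formalization: Missing subspheres are required to be nonempty (W ≠ 0); otherwise (2) fails for complete graphs, where the complement of Σ¹ is empty and the empty sphere would be a maximal missing subsphere although there is no separating subgraph. *)

theory Defs
  imports
    "HOL-Analysis.Analysis"
    "HOL-Algebra.Elementary_Groups"
    "Graph_Theory.Graph_Theory"
begin

section \<open>Graphs and flag complexes\<close>

text \<open>A finite simplicial graph is a symmetric loop-free digraph: the locale \<open>pair_graph\<close>
  of the entry Graph\_Theory. Every edge is present in both orientations. Full subgraphs are
  its \<open>induced_subgraph\<close>s. The name \<open>connected\<close> is qualified because HOL-Analysis also uses it.\<close>

text \<open>The library's \<open>connected\<close> requires a vertex, so the empty graph has to be
  excluded here in order not to count as disconnected.\<close>

definition disconnected :: "('a, 'b) pre_digraph \<Rightarrow> bool" where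
  "disconnected G \<longleftrightarrow> verts G \<noteq> {} \<and> \<not> Digraph_Component.connected G"

definition separating :: "'v pair_pre_digraph \<Rightarrow> 'v pair_pre_digraph \<Rightarrow> bool" where
  "separating \<Gamma> \<Lambda> \<longleftrightarrow>
     subgraph (with_proj \<Lambda>) (with_proj \<Gamma>) \<and>
     disconnected (with_proj \<Gamma> \<restriction> (pverts \<Gamma> - pverts \<Lambda>))"

definition cut_vertex :: "'v pair_pre_digraph \<Rightarrow> 'v \<Rightarrow> bool" where
  "cut_vertex \<Gamma> v \<longleftrightarrow> v \<in> pverts \<Gamma> \<and> separating \<Gamma> \<lparr>pverts = {v}, parcs = {}\<rparr>"

definition biconnected :: "'v pair_pre_digraph \<Rightarrow> bool" where
  "biconnected \<Gamma> \<longleftrightarrow> (\<nexists>v. cut_vertex \<Gamma> v)"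

definition min_full_separating :: "'v pair_pre_digraph \<Rightarrow> 'v pair_pre_digraph \<Rightarrow> bool" where
  "min_full_separating \<Gamma> \<Lambda> \<longleftrightarrow>
     induced_subgraph (with_proj \<Lambda>) (with_proj \<Gamma>) \<and> separating \<Gamma> \<Lambda> \<and>
     (\<forall>\<Lambda>'. induced_subgraph (with_proj \<Lambda>') (with_proj \<Lambda>) \<and> \<Lambda>' \<noteq> \<Lambda> \<longrightarrow> \<not> separating \<Gamma> \<Lambda>')"

definition flag_complex :: "'v pair_pre_digraph \<Rightarrow> 'v set set" where
  "flag_complex \<Gamma> =
     {\<sigma>. \<sigma> \<noteq> {} \<and> \<sigma> \<subseteq> pverts \<Gamma> \<and> (\<forall>v\<in>\<sigma>. \<forall>w\<in>\<sigma>. v \<noteq> w \<longrightarrow> (v, w) \<in> parcs \<Gamma>)}"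

definition geometric_realization :: "'v::finite set set \<Rightarrow> (real ^ 'v) set" where
  "geometric_realization K = (\<Union>\<sigma>\<in>K. convex hull ((\<lambda>v. axis v 1) ` \<sigma>))"


section \<open>Groups given by generators and relators\<close>

text \<open>The letter \<open>(x, True)\<close> stands for the generator \<open>x\<close> and \<open>(x, False)\<close> for its inverse.\<close>

type_synonym 'x word = "('x \<times> bool) list"

definition words :: "'x set \<Rightarrow> 'x word set" where
  "words X = lists (X \<times> UNIV)"

inductive_set word_rel :: "'x set \<Rightarrow> 'x word set \<Rightarrow> ('x word \<times> 'x word) set"
  for X :: "'x set" and R :: "'x word set" where
  refl: "w \<in> words X \<Longrightarrow> (w, w) \<in> word_rel X R"
| sym: "(u, w) \<in> word_rel X R \<Longrightarrow> (w, u) \<in> word_rel X R"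
| trans: "(u, v) \<in> word_rel X R \<Longrightarrow> (v, w) \<in> word_rel X R \<Longrightarrow> (u, w) \<in> word_rel X R"
| cancel: "u \<in> words X \<Longrightarrow> w \<in> words X \<Longrightarrow> x \<in> X \<Longrightarrow>
    (u @ [(x, b), (x, \<not> b)] @ w, u @ w) \<in> word_rel X R"
| relator: "u \<in> words X \<Longrightarrow> w \<in> words X \<Longrightarrow> r \<in> R \<Longrightarrow> r \<in> words X \<Longrightarrow>
    (u @ r @ w, u @ w) \<in> word_rel X R"

definition presented_group :: "'x set \<Rightarrow> 'x word set \<Rightarrow> 'x word set monoid" where
  "presented_group X R =
     \<lparr>carrier = words X // word_rel X R,
      monoid.mult = (\<lambda>a b. word_rel X R `` {u @ w | u w. u \<in> a \<and> w \<in> b}),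
      one = word_rel X R `` {[]}\<rparr>"

lemma words_simps [simp]:
  "[] \<in> words X"
  "p # w \<in> words X \<longleftrightarrow> fst p \<in> X \<and> w \<in> words X"
  "u @ w \<in> words X \<longleftrightarrow> u \<in> words X \<and> w \<in> words X"
  by (auto simp: words_def mem_Times_iff)

lemma word_rel_words:
  "(u, w) \<in> word_rel X R \<Longrightarrow> u \<in> words X \<and> w \<in> words X"
  by (induction rule: word_rel.induct) auto

lemma equiv_word_rel: "equiv (words X) (word_rel X R)"
  by (intro equivI refl_onI symI transI)
     (auto dest: word_rel_words intro: word_rel.refl word_rel.sym word_rel.trans)

lemma word_rel_append_left:
  "(u, w) \<in> word_rel X R \<Longrightarrow> z \<in> words X \<Longrightarrow> (z @ u, z @ w) \<in> word_rel X R"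
proof (induction rule: word_rel.induct)
  case (cancel u w x b)
  then show ?case using word_rel.cancel[of "z @ u" X w x b R] by simp
next
  case (relator u w r)
  then show ?case using word_rel.relator[of "z @ u" X w r R] by simp
qed (auto intro: word_rel.refl word_rel.sym word_rel.trans)

lemma word_rel_append_right:
  "(u, w) \<in> word_rel X R \<Longrightarrow> z \<in> words X \<Longrightarrow> (u @ z, w @ z) \<in> word_rel X R"
proof (induction rule: word_rel.induct)
  case (cancel u w x b)
  then show ?case using word_rel.cancel[of u X "w @ z" x b R] by simp
next
  case (relator u w r)
  then show ?case using word_rel.relator[of u X "w @ z" r R] by simp
qed (auto intro: word_rel.refl word_rel.sym word_rel.trans)

lemma word_rel_append:
  assumes "(u, u') \<in> word_rel X R" "(w, w') \<in> word_rel X R"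
  shows "(u @ w, u' @ w') \<in> word_rel X R"
  using assms word_rel_append_left word_rel_append_right word_rel_words word_rel.trans
  by metis

lemma presented_group_mult:
  assumes "u \<in> words X" "w \<in> words X"
  shows "word_rel X R `` {u} \<otimes>\<^bsub>presented_group X R\<^esub> word_rel X R `` {w} = word_rel X R `` {u @ w}"
proof -
  have "(u @ w, z) \<in> word_rel X R"
    if "(u, u') \<in> word_rel X R" "(w, w') \<in> word_rel X R" "(u' @ w', z) \<in> word_rel X R" for u' w' z
    using that word_rel_append word_rel.trans by metis
  moreover have "(u, u) \<in> word_rel X R" "(w, w) \<in> word_rel X R"
    using assms by (auto intro: word_rel.refl)
  ultimately show ?thesis
    unfolding presented_group_def by auto
qed

lemma word_rel_inverse:
  "w \<in> words X \<Longrightarrow> (rev (map (\<lambda>(x, b). (x, \<not> b)) w) @ w, []) \<in> word_rel X R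
     \<and> rev (map (\<lambda>(x, b). (x, \<not> b)) w) \<in> words X"
proof (induction w)
  case Nil
  then show ?case by (auto intro: word_rel.refl)
next
  case (Cons p w)
  obtain x b where p: "p = (x, b)" by force
  let ?w' = "rev (map (\<lambda>(x, b). (x, \<not> b)) w)"
  have "(?w' @ [(x, \<not> b), (x, \<not> \<not> b)] @ w, ?w' @ w) \<in> word_rel X R"
    using Cons p by (intro word_rel.cancel) auto
  with Cons p show ?case by (auto intro: word_rel.trans)
qed

lemma group_presented_group: "group (presented_group X R)"
proof (rule groupI)
  let ?G = "presented_group X R"
  let ?cl = "\<lambda>w. word_rel X R `` {w}"
  have car: "a \<in> carrier ?G \<longleftrightarrow> (\<exists>w\<in>words X. a = ?cl w)" for a
    by (auto simp: presented_group_def quotient_def)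
  have one: "\<one>\<^bsub>?G\<^esub> = ?cl []"
    by (simp add: presented_group_def)
  note mult = presented_group_mult[of _ X _ R]
  show "\<one>\<^bsub>?G\<^esub> \<in> carrier ?G"
    using one by (auto simp: car)
  show "a \<otimes>\<^bsub>?G\<^esub> b \<in> carrier ?G" if "a \<in> carrier ?G" "b \<in> carrier ?G" for a b
    using that by (fastforce simp: car mult)
  show "a \<otimes>\<^bsub>?G\<^esub> b \<otimes>\<^bsub>?G\<^esub> c = a \<otimes>\<^bsub>?G\<^esub> (b \<otimes>\<^bsub>?G\<^esub> c)"
    if "a \<in> carrier ?G" "b \<in> carrier ?G" "c \<in> carrier ?G" for a b c
    using that by (auto simp: car mult)
  show "\<one>\<^bsub>?G\<^esub> \<otimes>\<^bsub>?G\<^esub> a = a" if "a \<in> carrier ?G" for a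
    using that by (auto simp: car one mult)
  show "\<exists>b\<in>carrier ?G. b \<otimes>\<^bsub>?G\<^esub> a = \<one>\<^bsub>?G\<^esub>" if a: "a \<in> carrier ?G" for a
  proof -
    obtain w where w: "w \<in> words X" "a = ?cl w" using a car by auto
    let ?w' = "rev (map (\<lambda>(x, b). (x, \<not> b)) w)"
    have "?cl ?w' \<otimes>\<^bsub>?G\<^esub> a = ?cl (?w' @ w)"
      using w word_rel_inverse[of w X R] by (simp add: mult)
    also have "\<dots> = \<one>\<^bsub>?G\<^esub>"
      using w word_rel_inverse[of w X R] one equiv_class_eq[OF equiv_word_rel] by metis
    finally show ?thesis
      using w word_rel_inverse[of w X R] car by blast
  qed
qed


section \<open>Right-angled Artin groups and Bestvina--Brady groups\<close>

definition raag_relators :: "'v pair_pre_digraph \<Rightarrow> 'v word set" where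
  "raag_relators \<Gamma> = {[(v, True), (w, True), (v, False), (w, False)] | v w. (v, w) \<in> parcs \<Gamma>}"

definition raag :: "'v pair_pre_digraph \<Rightarrow> 'v word set monoid" where
  "raag \<Gamma> = presented_group (pverts \<Gamma>) (raag_relators \<Gamma>)"

definition raag_gen :: "'v pair_pre_digraph \<Rightarrow> 'v \<Rightarrow> 'v word set" where
  "raag_gen \<Gamma> v = word_rel (pverts \<Gamma>) (raag_relators \<Gamma>) `` {[(v, True)]}"

definition exponent_sum :: "'x word \<Rightarrow> int" where
  "exponent_sum w = (\<Sum>(x, b)\<leftarrow>w. if b then 1 else - 1)"

text \<open>The homomorphism to the integers sending every vertex generator to 1; all words
  in an element of \<open>raag \<Gamma>\<close> have the same exponent sum (see the lemmas below).\<close>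

definition raag_height :: "'v word set \<Rightarrow> int" where
  "raag_height a = the_elem (exponent_sum ` a)"

definition bestvina_brady :: "'v pair_pre_digraph \<Rightarrow> 'v word set monoid" where
  "bestvina_brady \<Gamma> = (raag \<Gamma>)\<lparr>carrier := kernel (raag \<Gamma>) integer_group raag_height\<rparr>"

definition bb_edge :: "'v pair_pre_digraph \<Rightarrow> 'v \<times> 'v \<Rightarrow> 'v word set" where
  "bb_edge \<Gamma> e = raag_gen \<Gamma> (snd e) \<otimes>\<^bsub>raag \<Gamma>\<^esub> inv\<^bsub>raag \<Gamma>\<^esub> (raag_gen \<Gamma> (fst e))"

lemma group_raag: "group (raag \<Gamma>)"
  by (simp add: raag_def group_presented_group)

lemma exponent_sum_append: "exponent_sum (u @ w) = exponent_sum u + exponent_sum w"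
  by (simp add: exponent_sum_def)

lemma exponent_sum_word_rel:
  "(u, w) \<in> word_rel X (raag_relators \<Gamma>) \<Longrightarrow> exponent_sum u = exponent_sum w"
  by (induction rule: word_rel.induct)
     (auto simp: exponent_sum_append exponent_sum_def raag_relators_def)

lemma raag_height_class:
  assumes "w \<in> words (pverts \<Gamma>)"
  shows "raag_height (word_rel (pverts \<Gamma>) (raag_relators \<Gamma>) `` {w}) = exponent_sum w"
proof -
  have "exponent_sum ` (word_rel (pverts \<Gamma>) (raag_relators \<Gamma>) `` {w}) = {exponent_sum w}"
    using assms exponent_sum_word_rel by (fastforce intro: word_rel.refl)
  then show ?thesis by (simp add: raag_height_def)
qed

lemma raag_height_hom: "raag_height \<in> hom (raag \<Gamma>) integer_group"
proof (rule homI)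
  fix a b assume "a \<in> carrier (raag \<Gamma>)" "b \<in> carrier (raag \<Gamma>)"
  then obtain u w where
    "u \<in> words (pverts \<Gamma>)" "a = word_rel (pverts \<Gamma>) (raag_relators \<Gamma>) `` {u}"
    "w \<in> words (pverts \<Gamma>)" "b = word_rel (pverts \<Gamma>) (raag_relators \<Gamma>) `` {w}"
    by (auto simp: raag_def presented_group_def quotient_def)
  then show "raag_height (a \<otimes>\<^bsub>raag \<Gamma>\<^esub> b) = raag_height a \<otimes>\<^bsub>integer_group\<^esub> raag_height b"
    by (simp add: raag_def presented_group_mult raag_height_class exponent_sum_append)
qed simp

lemma raag_gen_closed: "v \<in> pverts \<Gamma> \<Longrightarrow> raag_gen \<Gamma> v \<in> carrier (raag \<Gamma>)"
  by (auto simp: raag_gen_def raag_def presented_group_def intro: quotientI)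

lemma raag_height_gen: "v \<in> pverts \<Gamma> \<Longrightarrow> raag_height (raag_gen \<Gamma> v) = 1"
  by (simp add: raag_gen_def raag_height_class exponent_sum_def)

lemma group_bestvina_brady: "group (bestvina_brady \<Gamma>)"
proof -
  interpret group_hom "raag \<Gamma>" integer_group raag_height
    by (simp add: group_hom_def group_hom_axioms_def group_raag raag_height_hom)
  show ?thesis
    unfolding bestvina_brady_def by (rule G.subgroup_imp_group[OF subgroup_kernel])
qed

lemma bb_edge_closed:
  assumes "v \<in> pverts \<Gamma>" "w \<in> pverts \<Gamma>"
  shows "bb_edge \<Gamma> (v, w) \<in> carrier (bestvina_brady \<Gamma>)"
proof -
  interpret group_hom "raag \<Gamma>" integer_group raag_height
    by (simp add: group_hom_def group_hom_axioms_def group_raag raag_height_hom)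
  have [simp]: "inv\<^bsub>integer_group\<^esub> x = - x" for x
    by (rule group.inv_equality) auto
  show ?thesis
    using assms raag_gen_closed[of _ \<Gamma>] raag_height_gen[of _ \<Gamma>]
    by (simp add: bb_edge_def bestvina_brady_def kernel_def)
qed


section \<open>Characters and the BNS-invariant\<close>

definition real_group :: "real monoid" where
  "real_group = \<lparr>carrier = UNIV, monoid.mult = (+), one = 0\<rparr>"

text \<open>Elements of \<open>hom\<close> are unconstrained off the carrier; characters are normalised to
  vanish there, so that they form a real vector space under pointwise operations.\<close>

definition characters :: "('g, 'm) monoid_scheme \<Rightarrow> ('g \<Rightarrow> real) set" where
  "characters G = {\<phi> \<in> hom G real_group. \<forall>g. g \<notin> carrier G \<longrightarrow> \<phi> g = 0}"

definition char_class :: "('g \<Rightarrow> real) \<Rightarrow> ('g \<Rightarrow> real) set" where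
  "char_class \<phi> = {(\<lambda>g. c * \<phi> g) | c. c > 0}"

definition sphere_of :: "('g \<Rightarrow> real) set \<Rightarrow> ('g \<Rightarrow> real) set set" where
  "sphere_of W = char_class ` (W - {\<lambda>_. 0})"

definition character_sphere :: "('g, 'm) monoid_scheme \<Rightarrow> ('g \<Rightarrow> real) set set" where
  "character_sphere G = sphere_of (characters G)"

definition finite_generating_set :: "('g, 'm) monoid_scheme \<Rightarrow> 'g set \<Rightarrow> bool" where
  "finite_generating_set G S \<longleftrightarrow> finite S \<and> S \<subseteq> carrier G \<and> generate G S = carrier G"

text \<open>Arcs of the Cayley graph are directed, but \<open>connected\<close> refers to the underlying
  undirected graph.\<close>

definition cayley_graph :: "('g, 'm) monoid_scheme \<Rightarrow> 'g set \<Rightarrow> 'g pair_pre_digraph" where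
  "cayley_graph G S =
     \<lparr>pverts = carrier G, parcs = {(g, g \<otimes>\<^bsub>G\<^esub> s) | g s. g \<in> carrier G \<and> s \<in> S}\<rparr>"

text \<open>Connectivity does not depend on the choice of the finite generating set, nor on the
  representative of the class; \<open>BNS\<close> is meant for finitely generated groups.\<close>

definition BNS :: "('g, 'm) monoid_scheme \<Rightarrow> ('g \<Rightarrow> real) set set" where
  "BNS G = {char_class \<phi> | \<phi>. \<phi> \<in> characters G - {\<lambda>_. 0} \<and>
     (\<exists>S. finite_generating_set G S \<and>
        Digraph_Component.connected
          (with_proj (cayley_graph G S) \<restriction> {g \<in> carrier G. \<phi> g \<ge> 0}))}"

definition BNS_compl :: "('g, 'm) monoid_scheme \<Rightarrow> ('g \<Rightarrow> real) set set" where
  "BNS_compl G = character_sphere G - BNS G"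

definition char_subspace :: "('g, 'm) monoid_scheme \<Rightarrow> ('g \<Rightarrow> real) set \<Rightarrow> bool" where
  "char_subspace G W \<longleftrightarrow>
     W \<subseteq> characters G \<and> (\<lambda>_. 0) \<in> W \<and>
     (\<forall>\<phi>\<in>W. \<forall>\<psi>\<in>W. (\<lambda>g. \<phi> g + \<psi> g) \<in> W) \<and>
     (\<forall>c. \<forall>\<phi>\<in>W. (\<lambda>g. c * \<phi> g) \<in> W)"

text \<open>Subspheres are nonempty: the zero subspace does not count. Otherwise the empty set would
  be a maximal missing subsphere whenever the complement of the BNS-invariant is empty, as for
  complete graphs, which have no separating subgraphs.\<close>

definition missing_subsphere ::
    "('g, 'm) monoid_scheme \<Rightarrow> ('g \<Rightarrow> real) set set \<Rightarrow> bool" where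
  "missing_subsphere G T \<longleftrightarrow>
     T \<noteq> {} \<and> (\<exists>W. char_subspace G W \<and> T = sphere_of W) \<and> T \<subseteq> BNS_compl G"

definition maximal_missing_subsphere ::
    "('g, 'm) monoid_scheme \<Rightarrow> ('g \<Rightarrow> real) set set \<Rightarrow> bool" where
  "maximal_missing_subsphere G T \<longleftrightarrow>
     missing_subsphere G T \<and> (\<forall>T'. missing_subsphere G T' \<and> T \<subseteq> T' \<longrightarrow> T' = T)"

definition W_sub :: "'v pair_pre_digraph \<Rightarrow> 'v pair_pre_digraph \<Rightarrow> ('v word set \<Rightarrow> real) set" where
  "W_sub \<Gamma> \<Lambda> = {\<phi> \<in> characters (bestvina_brady \<Gamma>). \<forall>e\<in>parcs \<Lambda>. \<phi> (bb_edge \<Gamma> e) = 0}"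

definition S_sub :: "'v pair_pre_digraph \<Rightarrow> 'v pair_pre_digraph \<Rightarrow> ('v word set \<Rightarrow> real) set set" where
  "S_sub \<Gamma> \<Lambda> = sphere_of (W_sub \<Gamma> \<Lambda>)"

end

theory Submission
  imports Defs
begin

text \<open>Since \<open>\<Gamma>\<close> is connected, \<open>BB\<close> is generated by its edges and every character of \<open>BB\<close> is the
  restriction of a character of the Artin group given by a function \<open>f\<close> on the vertices, which is
  unique up to an additive constant.

  If \<open>f\<close> is constant on a separating set \<open>U\<close>, say zero, the Artin group acts on two copies of the
  line in such a way that the two sides of \<open>U\<close> only communicate near the origins; this yields a
  subset of \<open>BB\<close> whose coboundary stays at bounded height while the subset and its complement are
  both unbounded, so the class of the character is not in the BNS-invariant.

  Conversely, suppose that no separating set lies in a level set of \<open>f\<close>. Then for every real \<open>c\<close>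
  the vertices on which \<open>f\<close> is not near \<open>c\<close> span a connected dominating subgraph, and paths in the
  Cayley graph of the Artin group can be pushed uphill for the potential \<open>f - \<kappa> H\<^sup>2\<close>, where \<open>H\<close> is
  the height. The resulting paths project to paths in the half-space \<open>f \<ge> 0\<close> of \<open>BB\<close>.

  Simple connectivity only enters to show that minimal full separating subgraphs are connected, so
  that a function which is constant along their edges is constant on their vertices.\<close>

section \<open>Connectivity and separating vertex sets\<close>

text \<open>Inside \<open>BB\<close> there is no move attached to a single vertex, since a letter
  leaves height 0. In the Artin group each vertex gives a move and commuting letters give squares
  across which paths can be pushed; the price is that paths must come back to height 0. A letter at
  height \<open>H\<close> changes \<open>f - \<kappa> * H\<^sup>2\<close> to first order by
  \<open>f - 2 * \<kappa> * H\<close>, with the sign of the letter, so the levels near every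
  \<open>2 * \<kappa> * H\<close> matter and not just level 0. As \<open>f\<close> takes finitely
  many values, \<eta> can be half the least gap: an open interval of radius \<eta> then contains at
  most one value, so discarding the vertices near a level discards part of one level set. With
  \<kappa> = \<eta> / 8 a letter moves the relevant level by \<eta> / 4, little enough for uphill
  directions to survive one step. The absence of cut vertices serves the second claim: a separating
  set with a single vertex has no edges, so it would impose no condition on characters.\<close>

definition conn_on :: "'a set \<Rightarrow> 'a rel \<Rightarrow> bool" where
  "conn_on U E \<longleftrightarrow> U \<noteq> {} \<and> (\<forall>u\<in>U. \<forall>v\<in>U. (u, v) \<in> rtrancl_on U E)"

lemma rtrancl_on_mono:
  assumes "(u, v) \<in> rtrancl_on U E" "U \<subseteq> U'" "E \<inter> U \<times> U \<subseteq> E'"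
  shows "(u, v) \<in> rtrancl_on U' E'"
  using assms(1)
proof (induction rule: rtrancl_on_induct)
  case base
  then show ?case using assms(2) by auto
next
  case (step y z)
  then have "(y, z) \<in> E'" "z \<in> U'" using assms by auto
  with step.IH show ?case by (rule rtrancl_on_into_rtrancl_on)
qed

text \<open>The symmetric closure is kept because arcs of Cayley graphs are directed; for \<Gamma>
  it reduces to \<open>E\<close> by \<open>symcl_of_sym\<close>.\<close>

lemma connected_induce_subgraph_iff:
  "Digraph_Component.connected (with_proj P \<restriction> U) \<longleftrightarrow> conn_on U ((parcs P)\<^sup>s)"
proof -
  let ?M = "mk_symmetric (with_proj P \<restriction> U)"
  have V: "pverts ?M = U"
    by (simp add: mk_symmetric_def)
  have E: "parcs ?M = (parcs P)\<^sup>s \<inter> U \<times> U"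
    by (auto simp: mk_symmetric_def induce_subgraph_def symcl_def image_iff)
  have "rtrancl_on U (parcs ?M) = rtrancl_on U ((parcs P)\<^sup>s)"
    unfolding E by (auto elim!: rtrancl_on_mono)
  then show ?thesis
    unfolding Digraph_Component.connected_def strongly_connected_def conn_on_def reachable_def
    by (simp add: V)
qed

lemma symcl_of_sym: "sym E \<Longrightarrow> E\<^sup>s = E"
  by (auto simp: symcl_def image_iff sym_def)

lemma sym_symcl: "sym (E\<^sup>s)"
  by (auto simp: symcl_def sym_def image_iff)

lemma rtrancl_on_sym': "sym E \<Longrightarrow> (u, v) \<in> rtrancl_on U E \<Longrightarrow> (v, u) \<in> rtrancl_on U E"
  using rtrancl_on_sym[of E U] by (auto simp: sym_def)

lemma rtrancl_on_arc: "(u, v) \<in> E \<Longrightarrow> u \<in> U \<Longrightarrow> v \<in> U \<Longrightarrow> (u, v) \<in> rtrancl_on U E"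
  by (meson rtrancl_on_refl rtrancl_on_into_rtrancl_on)

definition full :: "'v pair_pre_digraph \<Rightarrow> 'v set \<Rightarrow> 'v pair_pre_digraph" where
  "full \<Gamma> U = \<lparr>pverts = U, parcs = parcs \<Gamma> \<inter> U \<times> U\<rparr>"

lemma full_simps [simp]:
  "pverts (full \<Gamma> U) = U" "parcs (full \<Gamma> U) = parcs \<Gamma> \<inter> U \<times> U"
  by (simp_all add: full_def)

locale simple_graph =
  fixes \<Gamma> :: "'v pair_pre_digraph"
  assumes pair_graph: "pair_graph \<Gamma>"
begin

abbreviation V :: "'v set" where "V \<equiv> pverts \<Gamma>"
abbreviation E :: "'v rel" where "E \<equiv> parcs \<Gamma>"

lemma finite_V: "finite V" and finite_E: "finite E"
  and arc_in_V: "(v, w) \<in> E \<Longrightarrow> v \<in> V \<and> w \<in> V"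
  and no_loop: "(v, v) \<notin> E"
  and sym_E: "sym E"
proof -
  interpret pair_graph \<Gamma> by (rule pair_graph)
  show "finite V" by (rule pair_finite_verts)
  show "finite E" by (rule pair_finite_arcs)
  show "v \<in> V \<and> w \<in> V" if "(v, w) \<in> E" using in_arcsD1[OF that] in_arcsD2[OF that] by auto
  show "(v, v) \<notin> E" using pair_no_loops[of "(v, v)"] by auto
  show "sym E" using pair_sym_arcs by (simp add: symmetric_def)
qed

lemma arc_sym: "(v, w) \<in> E \<Longrightarrow> (w, v) \<in> E"
  using sym_E by (auto simp: sym_def)

text \<open>Separation by a subgraph is decided by its vertices, so it is studied for sets. The
  complement is required to be nonempty because \<open>conn_on\<close> fails on the empty
  set.\<close>

definition sepset :: "'v set \<Rightarrow> bool" where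
  "sepset U \<longleftrightarrow> U \<subseteq> V \<and> V - U \<noteq> {} \<and> \<not> conn_on (V - U) E"

definition min_sepset :: "'v set \<Rightarrow> bool" where
  "min_sepset U \<longleftrightarrow> sepset U \<and> (\<forall>U'. U' \<subset> U \<longrightarrow> \<not> sepset U')"

lemma separating_iff:
  "separating \<Gamma> \<Lambda> \<longleftrightarrow> subgraph (with_proj \<Lambda>) (with_proj \<Gamma>) \<and> sepset (pverts \<Lambda>)"
  unfolding separating_def disconnected_def connected_induce_subgraph_iff sepset_def
    symcl_of_sym[OF sym_E]
  by (auto simp: subgraph_def)

lemma wf_digraph_iff: "wf_digraph (with_proj P) \<longleftrightarrow> parcs P \<subseteq> pverts P \<times> pverts P"
  by (force simp: wf_digraph_def)

lemma subgraph_iff: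
  "subgraph (with_proj \<Lambda>) (with_proj P) \<longleftrightarrow>
     pverts \<Lambda> \<subseteq> pverts P \<and> parcs \<Lambda> \<subseteq> parcs P \<and> parcs P \<subseteq> pverts P \<times> pverts P
     \<and> parcs \<Lambda> \<subseteq> pverts \<Lambda> \<times> pverts \<Lambda>"
  by (auto simp: subgraph_def wf_digraph_iff compatible_def)

lemma induced_iff:
  "induced_subgraph (with_proj \<Lambda>) (with_proj P) \<longleftrightarrow>
     parcs P \<subseteq> pverts P \<times> pverts P \<and> pverts \<Lambda> \<subseteq> pverts P \<and> \<Lambda> = full P (pverts \<Lambda>)"
proof -
  have "{e \<in> parcs P. fst e \<in> pverts \<Lambda> \<and> snd e \<in> pverts \<Lambda>} = parcs P \<inter> pverts \<Lambda> \<times> pverts \<Lambda>"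
    by auto
  moreover have "\<Lambda> = full P (pverts \<Lambda>) \<longleftrightarrow> parcs \<Lambda> = parcs P \<inter> pverts \<Lambda> \<times> pverts \<Lambda>"
    by (cases \<Lambda>) (auto simp: full_def)
  ultimately show ?thesis
    by (auto simp: induced_subgraph_def subgraph_iff)
qed

lemma E_subset: "E \<subseteq> V \<times> V"
  using arc_in_V by auto

text \<open>An induced subgraph of a full subgraph is again full in \<Gamma>, so proper full
  subgraphs of \<open>full \<Gamma> U\<close> correspond to proper subsets of
  \<open>U\<close>.\<close>

lemma min_full_separating_iff:
  "min_full_separating \<Gamma> \<Lambda> \<longleftrightarrow> (\<exists>U. min_sepset U \<and> \<Lambda> = full \<Gamma> U)"
proof
  assume m: "min_full_separating \<Gamma> \<Lambda>"
  then have ind: "\<Lambda> = full \<Gamma> (pverts \<Lambda>)" and sep: "sepset (pverts \<Lambda>)"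
    by (auto simp: min_full_separating_def separating_iff induced_iff)
  have "\<not> sepset U'" if "U' \<subset> pverts \<Lambda>" for U'
  proof
    assume "sepset U'"
    then have "separating \<Gamma> (full \<Gamma> U')"
      using E_subset by (auto simp: separating_iff subgraph_iff sepset_def)
    moreover have "induced_subgraph (with_proj (full \<Gamma> U')) (with_proj \<Lambda>)"
      using that by (subst ind) (auto simp: induced_iff full_def)
    moreover have "full \<Gamma> U' \<noteq> \<Lambda>" using that by auto
    ultimately show False using m by (auto simp: min_full_separating_def)
  qed
  with ind sep show "\<exists>U. min_sepset U \<and> \<Lambda> = full \<Gamma> U"
    by (auto simp: min_sepset_def)
next
  assume "\<exists>U. min_sepset U \<and> \<Lambda> = full \<Gamma> U"
  then obtain U where U: "min_sepset U" and \<Lambda>: "\<Lambda> = full \<Gamma> U" by auto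
  have "sepset U" using U by (simp add: min_sepset_def)
  moreover have "\<not> separating \<Gamma> \<Lambda>'"
    if "induced_subgraph (with_proj \<Lambda>') (with_proj \<Lambda>)" "\<Lambda>' \<noteq> \<Lambda>" for \<Lambda>'
  proof -
    have "pverts \<Lambda>' \<subseteq> U" "\<Lambda>' = full \<Lambda> (pverts \<Lambda>')"
      using that by (auto simp: induced_iff \<Lambda>)
    moreover have "pverts \<Lambda>' \<noteq> U"
    proof
      assume "pverts \<Lambda>' = U"
      with calculation(2) have "\<Lambda>' = full \<Lambda> U" by simp
      then have "\<Lambda>' = \<Lambda>" by (simp add: \<Lambda> full_def)
      then show False using that(2) by simp
    qed
    ultimately show ?thesis using U by (auto simp: separating_iff min_sepset_def)
  qed
  ultimately show "min_full_separating \<Gamma> \<Lambda>"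
    using E_subset
    by (auto simp: min_full_separating_def separating_iff induced_iff subgraph_iff \<Lambda> sepset_def)
qed

lemma sepset_imp_min_sepset:
  assumes "sepset U"
  obtains U' where "U' \<subseteq> U" "min_sepset U'"
proof -
  have "finite U" using assms finite_V by (auto simp: sepset_def intro: finite_subset)
  then have "\<exists>U'\<subseteq>U. min_sepset U'" using assms
  proof (induction U rule: finite_psubset_induct)
    case (psubset U)
    show ?case
    proof (cases "min_sepset U")
      case False
      then obtain U' where "U' \<subset> U" "sepset U'" using psubset.prems by (auto simp: min_sepset_def)
      with psubset.IH show ?thesis by (meson order.trans psubset_imp_subset)
    qed auto
  qed
  then show thesis using that by blast
qed

text \<open>Returning \<open>u\<close> to the complement must make it connected, so \<open>u\<close>
  has a neighbour in the component of \<open>a\<close>: each vertex of a minimal separating set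
  touches every complementary component.\<close>

lemma min_sepset_adjacent:
  assumes U: "min_sepset U" and u: "u \<in> U" and a: "a \<in> V - U"
  obtains b where "(a, b) \<in> rtrancl_on (V - U) E" "(b, u) \<in> E"
proof -
  have sub: "U \<subseteq> V" using U by (auto simp: min_sepset_def sepset_def)
  have "\<not> sepset (U - {u})" using U u by (auto simp: min_sepset_def)
  then have "conn_on (V - (U - {u})) E"
    using u sub by (auto simp: sepset_def)
  moreover have *: "V - (U - {u}) = insert u (V - U)" using u sub by auto
  ultimately have au: "(a, u) \<in> rtrancl_on (insert u (V - U)) E"
    using a by (auto simp: conn_on_def)
  have "(a, x) \<in> rtrancl_on (V - U) E \<or> (\<exists>b. (a, b) \<in> rtrancl_on (V - U) E \<and> (b, u) \<in> E)"
    if "(a, x) \<in> rtrancl_on (insert u (V - U)) E" for x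
    using that
  proof (induction rule: rtrancl_on_induct)
    case base
    then show ?case using a by blast
  next
    case (step y z)
    then show ?case by (metis insert_iff rtrancl_on_into_rtrancl_on)
  qed
  from this[OF au] show thesis
    using that u in_rtrancl_on_in_F(2) by fastforce
qed

lemma sepset_parts:
  assumes "sepset U"
  obtains a b where "a \<in> V - U" "b \<in> V - U" "(a, b) \<notin> rtrancl_on (V - U) E"
  using assms by (auto simp: sepset_def conn_on_def)

end


section \<open>Minimal separating sets are connected\<close>

lemma in_simplex_hull:
  fixes p :: "real ^ 'v::finite"
  assumes "p \<in> convex hull ((\<lambda>v. axis v 1) ` \<sigma>)"
  shows "\<And>x. 0 \<le> p $ x" "\<And>x. x \<notin> \<sigma> \<Longrightarrow> p $ x = 0" "\<exists>x\<in>\<sigma>. 0 < p $ x"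
proof -
  let ?C = "{p :: real ^ 'v. (\<forall>x. 0 \<le> p $ x) \<and> (\<forall>x. x \<notin> \<sigma> \<longrightarrow> p $ x = 0) \<and> (\<Sum>x\<in>UNIV. p $ x) = 1}"
  have "convex ?C"
    by (auto simp: convex_def sum.distrib simp flip: sum_distrib_left)
  moreover have "(\<lambda>v. axis v 1) ` \<sigma> \<subseteq> ?C"
    by (auto simp: axis_def)
  ultimately have "p \<in> ?C"
    using assms hull_minimal[of _ ?C convex] by blast
  then show *: "\<And>x. 0 \<le> p $ x" "\<And>x. x \<notin> \<sigma> \<Longrightarrow> p $ x = 0" by auto
  show "\<exists>x\<in>\<sigma>. 0 < p $ x"
  proof (rule ccontr)
    assume "\<not> ?thesis"
    then have "p $ x = 0" for x using *[of x] by (cases "x \<in> \<sigma>") force+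
    with \<open>p \<in> ?C\<close> show False by simp
  qed
qed

text \<open>A finite union of compact convex sets is an ANR. The existence of logarithms on a simply
  connected set asks for this local condition.\<close>

lemma locally_path_connected_realization:
  fixes K :: "'v::finite set set"
  shows "locally path_connected (geometric_realization K)"
  unfolding geometric_realization_def
  by (intro ANR_imp_locally_path_connected ANR_finite_Union_convex_closed)
    (auto intro!: compact_imp_closed finite_imp_compact_convex_hull)

text \<open>On the closed right half-plane without 0 the principal logarithm is continuous. The
  difference is thus continuous with exponential \<open>1 / c\<close>, so its values differ by
  multiples of \<open>2 * pi * \<i>\<close>, and on a connected set it cannot jump.\<close>

lemma log_const_on_connected:
  fixes F :: "'a::topological_space \<Rightarrow> complex"
  assumes S: "topological_space_class.connected S" and g: "continuous_on S g" and F: "continuous_on S F"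
    and exp: "\<And>p. p \<in> S \<Longrightarrow> F p = exp (g p)"
    and pos: "\<And>p. p \<in> S \<Longrightarrow> 0 \<le> Re (c * F p)" and c: "c \<noteq> 0"
    and xy: "x \<in> S" "y \<in> S"
  shows "g x - Ln (c * F x) = g y - Ln (c * F y)"
proof -
  let ?k = "\<lambda>p. g p - Ln (c * F p)"
  have nz: "F p \<noteq> 0" if "p \<in> S" for p using exp[OF that] by simp
  have "continuous_on S ?k"
  proof (intro continuous_intros g continuous_on_Ln' F)
    show "c * F p \<notin> \<real>\<^sub>\<le>\<^sub>0" if "p \<in> S" for p
      using pos[OF that] nz[OF that] c by (metis antisym complex_eq_iff complex_nonpos_Reals_iff
          mult_eq_0_iff zero_complex.simps)
  qed
  moreover have "exp (?k p) = 1 / c" if "p \<in> S" for p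
    using nz[OF that] exp[OF that] c by (simp add: exp_diff exp_Ln)
  then have "\<exists>e>0. \<forall>q. q \<in> S \<and> ?k q \<noteq> ?k p \<longrightarrow> e \<le> norm (?k q - ?k p)" if "p \<in> S" for p
  proof (intro exI[of _ "2 * pi"] conjI allI impI)
    fix q assume q: "q \<in> S \<and> ?k q \<noteq> ?k p"
    then have "exp (?k q) = exp (?k p)"
      using \<open>\<And>p. p \<in> S \<Longrightarrow> exp (?k p) = 1 / c\<close> that by metis
    then obtain n :: int where n: "?k q = ?k p + (of_int (2 * n) * pi) * \<i>"
      unfolding exp_eq by auto
    with q have "n \<noteq> 0" by auto
    then have "1 \<le> \<bar>real_of_int n\<bar>" by linarith
    moreover have "norm (?k q - ?k p) = 2 * pi * \<bar>real_of_int n\<bar>"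
      unfolding n by (simp add: norm_mult)
    ultimately show "2 * pi \<le> norm (?k q - ?k p)" using pi_gt_zero
      by (simp add: mult_left_mono)
  qed auto
  ultimately have "?k constant_on S"
    using continuous_discrete_range_constant[OF S, of ?k] by blast
  then show ?thesis using xy by (auto simp: constant_on_def)
qed

text \<open>If a minimal separating set \<open>U\<close> splits as \<open>L\<^sub>1 \<union> L\<^sub>2\<close> and its complement as \<open>A \<union> B\<close>, sending
  \<open>A, L\<^sub>1, B, L\<^sub>2\<close> to \<open>1, \<i>, -1, -\<i>\<close> extends linearly to a map from the realization to the
  punctured plane. A closed edge path through \<open>A, L\<^sub>1, B, L\<^sub>2\<close> in this order winds around 0, which
  contradicts the existence of a logarithm.\<close>

lemma min_sepset_rtrancl_on:
  fixes \<Gamma> :: "'v::finite pair_pre_digraph"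
  assumes \<Gamma>: "simple_graph \<Gamma>"
    and sc: "simply_connected (geometric_realization (flag_complex \<Gamma>))"
    and U: "simple_graph.min_sepset \<Gamma> U" and uv: "u \<in> U" "v \<in> U"
  shows "(u, v) \<in> rtrancl_on U (parcs \<Gamma>)"
proof (rule ccontr)
  interpret simple_graph \<Gamma> by (rule \<Gamma>)
  assume nuv: "(u, v) \<notin> rtrancl_on U E"
  let ?K = "geometric_realization (flag_complex \<Gamma>)"
  have sep: "sepset U" and UV: "U \<subseteq> V" using U by (auto simp: min_sepset_def sepset_def)
  obtain a b where ab: "a \<in> V - U" "b \<in> V - U" "(a, b) \<notin> rtrancl_on (V - U) E"
    using sepset_parts[OF sep] .
  define A where "A = {x. (a, x) \<in> rtrancl_on (V - U) E}"
  define B where "B = V - U - A"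
  define L where "L = {x. (u, x) \<in> rtrancl_on U E}"
  have AV: "A \<subseteq> V - U" and LU: "L \<subseteq> U" unfolding A_def L_def using in_rtrancl_on_in_F by fastforce+
  have AB: "(x, y) \<notin> E" if "x \<in> A" "y \<in> B" for x y
    using that by (auto simp: A_def B_def dest: rtrancl_on_into_rtrancl_on)
  have LL: "(x, y) \<notin> E" if "x \<in> L" "y \<in> U - L" for x y
    using that by (auto simp: L_def dest: rtrancl_on_into_rtrancl_on)
  have uL: "u \<in> L" "v \<notin> L" using uv nuv by (auto simp: L_def)
  \<comment> \<open>Elements of the type outside \<open>V\<close> also receive
    \<open>- \<i>\<close>; they lie in no simplex.\<close>
  define h :: "'v \<Rightarrow> complex" where
    "h x = (if x \<in> A then 1 else if x \<in> B then - 1 else if x \<in> L then \<i> else - \<i>)" for x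
  define F :: "real ^ 'v \<Rightarrow> complex" where "F p = (\<Sum>x\<in>UNIV. complex_of_real (p $ x) * h x)" for p
  have Re_F: "Re (F p) = (\<Sum>x\<in>UNIV. p $ x * Re (h x))"
    and Im_F: "Im (F p) = (\<Sum>x\<in>UNIV. p $ x * Im (h x))" for p
    by (simp_all add: F_def)
  have F_axis: "F (axis x 1) = h x" for x
  proof -
    have "F (axis x 1) = (\<Sum>y\<in>UNIV. if y = x then h x else 0)"
      unfolding F_def by (intro sum.cong) (auto simp: axis_def)
    then show ?thesis by simp
  qed
  have F_cont: "continuous_on S F" for S
    unfolding F_def by (intro continuous_intros)
  have h_Re: "0 \<le> Re (h x)" if "x \<notin> B" for x using that by (auto simp: h_def)
  have h_Re': "Re (h x) \<le> 0" if "x \<notin> A" for x using that by (auto simp: h_def)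
  have F_nz: "F p \<noteq> 0" if pK: "p \<in> ?K" for p
  proof -
    obtain \<sigma> where \<sigma>: "\<sigma> \<in> flag_complex \<Gamma>" "p \<in> convex hull ((\<lambda>v. axis v 1) ` \<sigma>)"
      using pK by (auto simp: geometric_realization_def)
    note p = in_simplex_hull[OF \<sigma>(2)]
    have \<sigma>V: "\<sigma> \<subseteq> V" using \<sigma>(1) by (auto simp: flag_complex_def)
    have \<sigma>E: "(x, y) \<in> E" if "x \<in> \<sigma>" "y \<in> \<sigma>" "x \<noteq> y" for x y
      using \<sigma>(1) that by (auto simp: flag_complex_def)
    obtain x where x: "x \<in> \<sigma>" "0 < p $ x" using p(3) by auto
    have pos: "0 < (\<Sum>y\<in>UNIV. p $ y * q y)"
      if "0 < q x" "\<And>y. y \<in> \<sigma> \<Longrightarrow> 0 \<le> q y" for q :: "'v \<Rightarrow> real"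
    proof -
      have "0 \<le> p $ y * q y" for y
        using p(1,2)[of y] that(2)[of y] by (cases "y \<in> \<sigma>") auto
      moreover have "0 < p $ x * q x" using x that by simp
      ultimately show ?thesis by (intro sum_pos2[of _ x]) auto
    qed
    \<comment> \<open>A simplex cannot meet both \<open>A\<close> and \<open>B\<close>, nor both
      \<open>L\<close> and \<open>U - L\<close>. The class of a vertex with positive weight
      therefore selects an axis along which no vertex of the simplex contributes with the opposite
      sign.\<close>
    consider "x \<in> A" | "x \<in> B" | "x \<in> L" | "x \<in> U - L"
      unfolding B_def using x(1) \<sigma>V by blast
    then show ?thesis
    proof cases
      case 1
      then have "y \<notin> B" if "y \<in> \<sigma>" for y using AB[of x y] \<sigma>E[of x y] x that by (auto simp: B_def)
      then have "0 < Re (F p)" unfolding Re_F using 1 h_Re by (intro pos) (auto simp: h_def)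
      then show ?thesis by auto
    next
      case 2
      then have "y \<notin> A" if "y \<in> \<sigma>" for y using AB[of y x] \<sigma>E[of y x] x that by (auto simp: B_def)
      then have "0 < (\<Sum>y\<in>UNIV. p $ y * - Re (h y))"
        using 2 h_Re' by (intro pos) (auto simp: h_def B_def)
      then have "Re (F p) < 0" unfolding Re_F by (simp add: sum_negf)
      then show ?thesis by auto
    next
      case 3
      then have "y \<in> A \<union> B \<union> L" if "y \<in> \<sigma>" for y
        unfolding B_def using 3 LL \<sigma>E x(1) \<sigma>V that by blast
      then have "0 < Im (F p)" unfolding Im_F
        using 3 AV LU by (intro pos) (auto simp: h_def B_def)
      then show ?thesis by auto
    next
      case 4
      then have "y \<notin> L" if "y \<in> \<sigma>" for y using 4 LL \<sigma>E x(1) that by blast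
      then have "0 < (\<Sum>y\<in>UNIV. p $ y * - Im (h y))"
        using 4 AV by (intro pos) (auto simp: h_def B_def)
      then have "Im (F p) < 0" unfolding Im_F by (simp add: sum_negf)
      then show ?thesis by auto
    qed
  qed
  obtain g where g: "continuous_on ?K g" "\<And>p. p \<in> ?K \<Longrightarrow> F p = exp (g p)"
    using continuous_logarithm_on_simply_connected[OF F_cont sc
        locally_path_connected_realization F_nz] by blast
  \<comment> \<open>\<open>k 1\<close> and \<open>k (- 1)\<close> compare \<open>g\<close> with the
    principal logarithm on the right and on the left half-plane; each is constant along edges that
    \<open>h\<close> keeps in the respective closed half-plane.\<close>
  define k where "k c x = g (axis x 1) - Ln (c * h x)" for c x
  have k_edge: "k c x = k c y"
    if e: "(x, y) \<in> E" "c \<noteq> 0" "\<And>z. z \<in> {x, y} \<Longrightarrow> 0 \<le> Re (c * h z)" "Im c = 0" for c x y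
  proof -
    let ?S = "convex hull ((\<lambda>v. axis v (1::real)) ` {x, y})"
    have "{x, y} \<in> flag_complex \<Gamma>"
      using e(1) arc_in_V[OF e(1)] arc_sym[OF e(1)] by (auto simp: flag_complex_def)
    then have SK: "?S \<subseteq> ?K" by (auto simp: geometric_realization_def)
    have "0 \<le> Re (c * F p)" if p: "p \<in> ?S" for p
    proof -
      have "0 \<le> (\<Sum>z\<in>UNIV. p $ z * Re (c * h z))"
      proof (rule sum_nonneg)
        fix z show "0 \<le> p $ z * Re (c * h z)"
          using in_simplex_hull(1,2)[OF p, of z] e(3)[of z] by (cases "z \<in> {x, y}") auto
      qed
      also have "\<dots> = Re (c * F p)"
        using \<open>Im c = 0\<close> by (simp add: Re_F sum_distrib_left mult_ac)
      finally show ?thesis .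
    qed
    then have "g (axis x 1) - Ln (c * F (axis x 1)) = g (axis y 1) - Ln (c * F (axis y 1))"
      using SK e(2) g
      by (intro log_const_on_connected[of ?S] continuous_on_subset[OF g(1)] F_cont
          convex_connected convex_convex_hull) (auto intro: hull_inc)
    then show ?thesis by (simp add: k_def F_axis)
  qed
  have k_reach: "k c x = k c y"
    if "(x, y) \<in> rtrancl_on (V - U) E" "c \<noteq> 0" "Im c = 0"
       "\<And>z. (x, z) \<in> rtrancl_on (V - U) E \<Longrightarrow> 0 \<le> Re (c * h z)" for c x y
    using that(1)
  proof (induction rule: rtrancl_on_induct)
    case base
    then show ?case by simp
  next
    case (step y z)
    have "(x, z) \<in> rtrancl_on (V - U) E" using step.hyps by (meson rtrancl_on_into_rtrancl_on)
    then have "k c y = k c z" using step.hyps that by (intro k_edge) auto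
    then show ?case using step.IH by simp
  qed
  \<comment> \<open>Each vertex of \<open>U\<close> has a neighbour in the component of
    \<open>x\<close>, and \<open>h\<close> is imaginary on \<open>U\<close>, so entering
    \<open>U\<close> from this component stays in the closed half-plane.\<close>
  have k_uv: "k c u = k c v"
    if e: "x \<in> V - U" "c \<noteq> 0" "Im c = 0"
       "\<And>z. (x, z) \<in> rtrancl_on (V - U) E \<Longrightarrow> 0 \<le> Re (c * h z)" for c x
  proof -
    have "k c x = k c w" if w: "w \<in> U" for w
    proof -
      obtain y where y: "(x, y) \<in> rtrancl_on (V - U) E" "(y, w) \<in> E"
        using min_sepset_adjacent[OF U w e(1)] .
      have "Re (h w) = 0" using w AV by (auto simp: h_def B_def)
      then have "k c y = k c w"
        using y e \<open>Im c = 0\<close> by (intro k_edge) auto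
      with k_reach[OF y(1)] e show ?thesis by simp
    qed
    from this[of u] this[of v] show ?thesis using uv by simp
  qed
  have "k 1 u = k 1 v"
  proof (rule k_uv[OF ab(1)])
    show "0 \<le> Re (1 * h z)" if "(a, z) \<in> rtrancl_on (V - U) E" for z
      using that h_Re[of z] by (auto simp: A_def B_def)
  qed auto
  moreover have "k (- 1) u = k (- 1) v"
  proof (rule k_uv[OF ab(2)])
    show "0 \<le> Re (- 1 * h z)" if "(b, z) \<in> rtrancl_on (V - U) E" for z
    proof -
      have "z \<notin> A"
        using that ab(3) rtrancl_on_sym'[OF sym_E] rtrancl_on_trans by (fastforce simp: A_def)
      then show ?thesis using h_Re'[of z] by simp
    qed
  qed auto
  moreover have "h u = \<i>" "h v = - \<i>"
    using uv uL AV by (auto simp: h_def B_def)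
  \<comment> \<open>The two equations express the difference of \<open>g\<close> at \<open>u\<close>
    and \<open>v\<close> once as \<open>Ln \<i> - Ln (- \<i>)\<close> and once as the negative of
    it.\<close>
  ultimately have "Ln \<i> = Ln (- \<i>)" by (simp add: k_def algebra_simps)
  then have "\<i> = - \<i>" by (metis exp_Ln neg_equal_zero complex_i_not_zero neg_equal_0_iff_equal)
  then show False by (simp add: complex_eq_iff)
qed


section \<open>Characters of Bestvina--Brady groups\<close>

context simple_graph
begin

abbreviation A :: "'v word set monoid" where "A \<equiv> raag \<Gamma>"
abbreviation BB :: "'v word set monoid" where "BB \<equiv> bestvina_brady \<Gamma>"
abbreviation H :: "'v word set \<Rightarrow> int" where "H \<equiv> raag_height"

definition cl :: "'v word \<Rightarrow> 'v word set" where
  "cl w = word_rel V (raag_relators \<Gamma>) `` {w}"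

definition letter :: "'v \<times> bool \<Rightarrow> 'v word set" where
  "letter l = cl [l]"

sublocale A: group A by (rule group_raag)
sublocale BB: group BB by (rule group_bestvina_brady)

lemma cl_eqI: "(u, w) \<in> word_rel V (raag_relators \<Gamma>) \<Longrightarrow> cl u = cl w"
  unfolding cl_def by (rule equiv_class_eq[OF equiv_word_rel])

lemma carrier_A: "a \<in> carrier A \<longleftrightarrow> (\<exists>w\<in>words V. a = cl w)"
  by (auto simp: raag_def presented_group_def quotient_def cl_def)

lemma cl_closed [simp]: "w \<in> words V \<Longrightarrow> cl w \<in> carrier A"
  by (auto simp: carrier_A)

lemma cl_append: "u \<in> words V \<Longrightarrow> w \<in> words V \<Longrightarrow> cl (u @ w) = cl u \<otimes>\<^bsub>A\<^esub> cl w"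
  by (simp add: cl_def raag_def presented_group_mult)

lemma cl_Nil: "cl [] = \<one>\<^bsub>A\<^esub>"
  by (simp add: cl_def raag_def presented_group_def)

lemma letter_closed [simp]: "fst l \<in> V \<Longrightarrow> letter l \<in> carrier A"
  by (simp add: letter_def)

lemma cl_Cons: "fst l \<in> V \<Longrightarrow> w \<in> words V \<Longrightarrow> cl (l # w) = letter l \<otimes>\<^bsub>A\<^esub> cl w"
  using cl_append[of "[l]" w] by (simp add: letter_def)

lemma cl_snoc: "fst l \<in> V \<Longrightarrow> w \<in> words V \<Longrightarrow> cl (w @ [l]) = cl w \<otimes>\<^bsub>A\<^esub> letter l"
  using cl_append[of w "[l]"] by (simp add: letter_def)

lemma raag_gen_eq: "raag_gen \<Gamma> v = letter (v, True)"
  by (simp add: raag_gen_def letter_def cl_def)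

lemma letter_cancel: "v \<in> V \<Longrightarrow> letter (v, b) \<otimes>\<^bsub>A\<^esub> letter (v, \<not> b) = \<one>\<^bsub>A\<^esub>"
proof -
  assume v: "v \<in> V"
  have "cl ([] @ [(v, b), (v, \<not> b)] @ []) = cl ([] @ [])"
    using v by (intro cl_eqI word_rel.cancel) auto
  then show ?thesis using v by (simp add: cl_Cons cl_Nil)
qed

lemma letter_neg: "v \<in> V \<Longrightarrow> letter (v, \<not> b) = inv\<^bsub>A\<^esub> letter (v, b)"
  using letter_cancel[of v "\<not> b"] by (intro A.inv_equality[symmetric]) auto

lemma letter_False: "v \<in> V \<Longrightarrow> letter (v, False) = inv\<^bsub>A\<^esub> letter (v, True)"
  using letter_neg[of v True] by simp

lemma gen_commute:
  assumes "(v, w) \<in> E"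
  shows "letter (v, True) \<otimes>\<^bsub>A\<^esub> letter (w, True) = letter (w, True) \<otimes>\<^bsub>A\<^esub> letter (v, True)"
proof -
  have vw: "v \<in> V" "w \<in> V" using arc_in_V assms by auto
  have "cl ([] @ [(v, True), (w, True), (v, False), (w, False)] @ []) = cl ([] @ [])"
    using vw assms by (intro cl_eqI word_rel.relator) (auto simp: raag_relators_def)
  then have "(letter (v, True) \<otimes>\<^bsub>A\<^esub> letter (w, True)) \<otimes>\<^bsub>A\<^esub>
      inv\<^bsub>A\<^esub> (letter (w, True) \<otimes>\<^bsub>A\<^esub> letter (v, True)) = \<one>\<^bsub>A\<^esub>"
    using vw by (simp add: cl_Cons cl_Nil letter_False A.inv_mult_group A.m_assoc)
  then show ?thesis
    using vw by (metis A.inv_closed A.inv_equality A.inv_inv A.m_closed letter_closed fst_conv)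
qed

lemma letter_commute:
  assumes "(v, w) \<in> E"
  shows "letter (v, b) \<otimes>\<^bsub>A\<^esub> letter (w, c) = letter (w, c) \<otimes>\<^bsub>A\<^esub> letter (v, b)"
proof -
  have vw: "v \<in> V" "w \<in> V" using arc_in_V assms by auto
  have inv_comm: "x \<otimes>\<^bsub>A\<^esub> inv\<^bsub>A\<^esub> y = inv\<^bsub>A\<^esub> y \<otimes>\<^bsub>A\<^esub> x"
    if "x \<otimes>\<^bsub>A\<^esub> y = y \<otimes>\<^bsub>A\<^esub> x" "x \<in> carrier A" "y \<in> carrier A" for x y
  proof -
    have "inv\<^bsub>A\<^esub> y \<otimes>\<^bsub>A\<^esub> x = inv\<^bsub>A\<^esub> y \<otimes>\<^bsub>A\<^esub> ((x \<otimes>\<^bsub>A\<^esub> y) \<otimes>\<^bsub>A\<^esub> inv\<^bsub>A\<^esub> y)"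
      using that(2,3) by (simp add: A.m_assoc)
    also have "\<dots> = (inv\<^bsub>A\<^esub> y \<otimes>\<^bsub>A\<^esub> y) \<otimes>\<^bsub>A\<^esub> (x \<otimes>\<^bsub>A\<^esub> inv\<^bsub>A\<^esub> y)"
      unfolding that(1) using that(2,3) by (simp only: A.m_assoc A.inv_closed A.m_closed)
    finally show ?thesis using that(2,3) by simp
  qed
  note g = gen_commute[OF assms]
  show ?thesis
    using g inv_comm[OF g] inv_comm[OF g[symmetric]] inv_comm[OF inv_comm[OF g[symmetric], symmetric]] vw
    by (cases b; cases c) (auto simp: letter_False)
qed

lemma A_induct [consumes 1, case_names one step]:
  assumes "a \<in> carrier A" "P \<one>\<^bsub>A\<^esub>"
    and step: "\<And>a l. a \<in> carrier A \<Longrightarrow> fst l \<in> V \<Longrightarrow> P a \<Longrightarrow> P (a \<otimes>\<^bsub>A\<^esub> letter l)"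
  shows "P a"
proof -
  obtain w where w: "w \<in> words V" "a = cl w" using assms(1) by (auto simp: carrier_A)
  have "w \<in> words V \<Longrightarrow> P (cl w)" for w
  proof (induction w rule: rev_induct)
    case Nil
    then show ?case using assms(2) by (simp add: cl_Nil)
  next
    case (snoc l w)
    then show ?case by (simp add: cl_snoc step)
  qed
  with w show ?thesis by simp
qed

section \<open>Characters of the Artin group\<close>

definition val :: "('v \<Rightarrow> real) \<Rightarrow> 'v \<times> bool \<Rightarrow> real" where
  "val f l = (if snd l then f (fst l) else - f (fst l))"

text \<open>The character of the Artin group with value \<open>f v\<close> at the generator
  \<open>v\<close>, read off from any word of the class; \<open>sum_val_word_rel\<close> makes
  \<open>the_elem\<close> meaningful.\<close>

definition chr :: "('v \<Rightarrow> real) \<Rightarrow> 'v word set \<Rightarrow> real" where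
  "chr f a = the_elem ((\<lambda>w. \<Sum>l\<leftarrow>w. val f l) ` a)"

lemma sum_val_word_rel:
  "(u, w) \<in> word_rel V (raag_relators \<Gamma>) \<Longrightarrow> (\<Sum>l\<leftarrow>u. val f l) = (\<Sum>l\<leftarrow>w. val f l)"
  by (induction rule: word_rel.induct) (auto simp: raag_relators_def val_def)

lemma chr_cl: "w \<in> words V \<Longrightarrow> chr f (cl w) = (\<Sum>l\<leftarrow>w. val f l)"
proof -
  assume "w \<in> words V"
  then have "(\<lambda>w. \<Sum>l\<leftarrow>w. val f l) ` cl w = {\<Sum>l\<leftarrow>w. val f l}"
    using sum_val_word_rel[of w _ f] unfolding cl_def by (force intro: word_rel.refl)
  then show ?thesis by (simp add: chr_def)
qed

lemma chr_mult:
  "a \<in> carrier A \<Longrightarrow> b \<in> carrier A \<Longrightarrow> chr f (a \<otimes>\<^bsub>A\<^esub> b) = chr f a + chr f b"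
  by (auto simp: carrier_A chr_cl simp flip: cl_append)

lemma chr_one: "chr f \<one>\<^bsub>A\<^esub> = 0"
  using chr_cl[of "[]" f] by (simp add: cl_Nil)

lemma chr_inv:
  assumes "a \<in> carrier A"
  shows "chr f (inv\<^bsub>A\<^esub> a) = - chr f a"
proof -
  have "chr f a + chr f (inv\<^bsub>A\<^esub> a) = chr f (a \<otimes>\<^bsub>A\<^esub> inv\<^bsub>A\<^esub> a)"
    using assms by (simp only: chr_mult A.inv_closed)
  also have "\<dots> = 0" using assms by (simp only: A.r_inv chr_one)
  finally show ?thesis by linarith
qed

lemma chr_letter: "fst l \<in> V \<Longrightarrow> chr f (letter l) = val f l"
  by (simp add: letter_def chr_cl)

lemma chr_pow: "a \<in> carrier A \<Longrightarrow> chr f (a [^]\<^bsub>A\<^esub> (n::nat)) = n * chr f a"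
  by (induction n) (simp_all add: chr_one chr_mult distrib_right)

lemma chr_int_pow:
  fixes n :: int
  assumes "a \<in> carrier A"
  shows "chr f (a [^]\<^bsub>A\<^esub> n) = of_int n * chr f a"
proof (cases n rule: int_cases2)
  case (nonneg m)
  then show ?thesis using assms by (simp only: int_pow_int chr_pow of_int_of_nat_eq)
next
  case (nonpos m)
  then show ?thesis
    using assms by (simp only: A.int_pow_neg_int chr_pow chr_inv A.nat_pow_closed of_int_minus
        of_int_of_nat_eq minus_mult_left)
qed

lemma height_cl: "w \<in> words V \<Longrightarrow> H (cl w) = exponent_sum w"
  by (simp add: cl_def raag_height_class)

text \<open>The height is itself a character of this family, so its rules are inherited from
  \<open>chr\<close>; it is also the reason why constants are invisible on
  \<open>BB\<close>.\<close>

lemma chr_const: "a \<in> carrier A \<Longrightarrow> chr (\<lambda>_. 1) a = H a"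
proof -
  have "(\<Sum>l\<leftarrow>w. val (\<lambda>_. 1) l) = exponent_sum w" for w :: "'v word"
    by (induction w) (auto simp: exponent_sum_def val_def)
  then show "a \<in> carrier A \<Longrightarrow> chr (\<lambda>_. 1) a = H a"
    by (auto simp: carrier_A chr_cl height_cl)
qed

lemma chr_lin:
  "a \<in> carrier A \<Longrightarrow> chr (\<lambda>v. r * f v + s * g v) a = r * chr f a + s * chr g a"
proof -
  have "(\<Sum>l\<leftarrow>w. val (\<lambda>v. r * f v + s * g v) l) = r * (\<Sum>l\<leftarrow>w. val f l) + s * (\<Sum>l\<leftarrow>w. val g l)"
    for w :: "'v word"
    by (induction w) (auto simp: val_def algebra_simps)
  then show "a \<in> carrier A \<Longrightarrow> chr (\<lambda>v. r * f v + s * g v) a = r * chr f a + s * chr g a"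
    by (auto simp: carrier_A chr_cl)
qed

lemma height_mult: "a \<in> carrier A \<Longrightarrow> b \<in> carrier A \<Longrightarrow> H (a \<otimes>\<^bsub>A\<^esub> b) = H a + H b"
  using chr_mult[of a b "\<lambda>_. 1"] by (simp add: chr_const flip: of_int_add)

lemma height_letter: "fst l \<in> V \<Longrightarrow> H (letter l) = (if snd l then 1 else - 1)"
  by (cases l) (auto simp: letter_def height_cl exponent_sum_def)

lemma carrier_BB: "a \<in> carrier BB \<longleftrightarrow> a \<in> carrier A \<and> H a = 0"
  by (auto simp: bestvina_brady_def kernel_def)

lemma subgroup_BB: "subgroup (carrier BB) A"
proof -
  interpret group_hom A integer_group H
    by (simp add: group_hom_def group_hom_axioms_def group_raag raag_height_hom)
  show ?thesis using subgroup_kernel by (simp add: bestvina_brady_def)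
qed

lemma BB_eq: "BB = A\<lparr>carrier := carrier BB\<rparr>"
  by (simp add: bestvina_brady_def)

lemma BB_mult [simp]: "x \<otimes>\<^bsub>BB\<^esub> y = x \<otimes>\<^bsub>A\<^esub> y"
  by (simp add: bestvina_brady_def)

lemma BB_one [simp]: "\<one>\<^bsub>BB\<^esub> = \<one>\<^bsub>A\<^esub>"
  by (simp add: bestvina_brady_def)

lemma BB_inv: "x \<in> carrier BB \<Longrightarrow> inv\<^bsub>BB\<^esub> x = inv\<^bsub>A\<^esub> x"
  using A.m_inv_consistent[OF subgroup_BB, of x] by (simp add: bestvina_brady_def)

lemma BB_in_A: "x \<in> carrier BB \<Longrightarrow> x \<in> carrier A"
  by (simp add: carrier_BB)

text \<open>Defined for all pairs of vertices, adjacent or not, so that characters can be evaluated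
  from a fixed base vertex.\<close>

definition edge :: "'v \<Rightarrow> 'v \<Rightarrow> 'v word set" where
  "edge v w = letter (w, True) \<otimes>\<^bsub>A\<^esub> letter (v, False)"

lemma bb_edge_eq: "v \<in> V \<Longrightarrow> bb_edge \<Gamma> (v, w) = edge v w"
  by (simp add: bb_edge_def raag_gen_eq edge_def letter_False)

lemma edge_in_A [simp]: "v \<in> V \<Longrightarrow> w \<in> V \<Longrightarrow> edge v w \<in> carrier A"
  by (simp add: edge_def)

lemma edge_in_BB [simp]: "v \<in> V \<Longrightarrow> w \<in> V \<Longrightarrow> edge v w \<in> carrier BB"
  by (simp add: edge_def carrier_BB height_mult height_letter)

lemma chr_edge: "v \<in> V \<Longrightarrow> w \<in> V \<Longrightarrow> chr f (edge v w) = f w - f v"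
  by (simp add: edge_def chr_mult chr_letter val_def)

lemma edge_mult: "u \<in> V \<Longrightarrow> v \<in> V \<Longrightarrow> w \<in> V \<Longrightarrow> edge v w \<otimes>\<^bsub>A\<^esub> edge u v = edge u w"
proof -
  assume *: "u \<in> V" "v \<in> V" "w \<in> V"
  then have "edge v w \<otimes>\<^bsub>A\<^esub> edge u v =
    letter (w, True) \<otimes>\<^bsub>A\<^esub> ((letter (v, False) \<otimes>\<^bsub>A\<^esub> letter (v, True)) \<otimes>\<^bsub>A\<^esub> letter (u, False))"
    by (simp add: edge_def A.m_assoc)
  also have "letter (v, False) \<otimes>\<^bsub>A\<^esub> letter (v, True) = \<one>\<^bsub>A\<^esub>"
    using letter_cancel[of v False] * by simp
  finally show ?thesis using * by (simp add: edge_def)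
qed

section \<open>Projections to height 0 and generation by edges\<close>

definition edges :: "'v word set set" where
  "edges = (\<lambda>(v, w). edge v w) ` E"

text \<open>For adjacent \<open>u\<close> and \<open>v\<close>, \<open>proj x u\<close> and \<open>proj x v\<close> differ by a power of a single edge
  element, so characters interpolate monotonically between them.\<close>

definition proj :: "'v word set \<Rightarrow> 'v \<Rightarrow> 'v word set" where
  "proj x u = x \<otimes>\<^bsub>A\<^esub> letter (u, True) [^]\<^bsub>A\<^esub> (- H x)"

lemma proj_in_BB: "x \<in> carrier A \<Longrightarrow> u \<in> V \<Longrightarrow> proj x u \<in> carrier BB"
proof -
  assume *: "x \<in> carrier A" "u \<in> V"
  have "real_of_int (H (letter (u, True) [^]\<^bsub>A\<^esub> (- H x))) = - H x"
    using * chr_int_pow[of "letter (u, True)" "\<lambda>_. 1" "- H x"]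
    by (simp add: chr_const chr_letter val_def height_letter)
  with * show ?thesis by (simp add: proj_def carrier_BB height_mult flip: of_int_minus)
qed

lemma chr_proj:
  fixes f :: "'v \<Rightarrow> real"
  shows "x \<in> carrier A \<Longrightarrow> u \<in> V \<Longrightarrow> chr f (proj x u) = chr f x - H x * f u"
  by (simp add: proj_def chr_mult chr_int_pow chr_letter val_def)

lemma proj_BB: "x \<in> carrier BB \<Longrightarrow> u \<in> V \<Longrightarrow> proj x u = x"
  by (simp add: proj_def carrier_BB)

text \<open>Both elements lie in the same left coset of the cyclic group of \<open>u\<close>, and
  \<open>proj\<close> picks the element of this coset at height 0.\<close>

lemma proj_mult_letter:
  assumes "x \<in> carrier A" "u \<in> V"
  shows "proj (x \<otimes>\<^bsub>A\<^esub> letter (u, b)) u = proj x u"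
proof -
  let ?g = "letter (u, True)"
  let ?e = "if b then 1 else - 1 :: int"
  have l: "letter (u, b) = ?g [^]\<^bsub>A\<^esub> ?e"
    using assms A.int_pow_1[of ?g] A.int_pow_neg[of ?g 1] letter_False[of u] by (cases b) simp_all
  have "H (x \<otimes>\<^bsub>A\<^esub> letter (u, b)) = H x + ?e"
    using assms by (simp add: height_mult height_letter)
  then have "proj (x \<otimes>\<^bsub>A\<^esub> letter (u, b)) u = x \<otimes>\<^bsub>A\<^esub> (?g [^]\<^bsub>A\<^esub> ?e \<otimes>\<^bsub>A\<^esub> ?g [^]\<^bsub>A\<^esub> (- H x - ?e))"
    using assms by (simp only: proj_def l A.m_assoc A.int_pow_closed letter_closed fst_conv minus_add_distrib)
      (simp only: diff_conv_add_uminus)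
  also have "?g [^]\<^bsub>A\<^esub> ?e \<otimes>\<^bsub>A\<^esub> ?g [^]\<^bsub>A\<^esub> (- H x - ?e) = ?g [^]\<^bsub>A\<^esub> (- H x)"
    using assms A.int_pow_mult[of ?g ?e "- H x - ?e"] by (simp only: letter_closed fst_conv) simp
  finally show ?thesis by (simp only: proj_def)
qed

text \<open>The letters of \<open>u\<close> and \<open>v\<close> commute, so a power of the edge
  element splits into a power of \<open>u\<close>, which cancels, and one of
  \<open>v\<close>.\<close>

lemma proj_adjacent:
  assumes "x \<in> carrier A" "(u, v) \<in> E"
  shows "proj x v = proj x u \<otimes>\<^bsub>A\<^esub> edge v u [^]\<^bsub>A\<^esub> H x"
proof -
  have uv: "u \<in> V" "v \<in> V" using assms arc_in_V by auto
  let ?g = "letter (u, True)" and ?h = "letter (v, True)"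
  have "edge v u [^]\<^bsub>A\<^esub> H x = ?g [^]\<^bsub>A\<^esub> H x \<otimes>\<^bsub>A\<^esub> (letter (v, False)) [^]\<^bsub>A\<^esub> H x"
    unfolding edge_def using uv letter_commute[OF assms(2)]
    by (intro A.int_pow_mult_distrib) auto
  also have "(letter (v, False)) [^]\<^bsub>A\<^esub> H x = ?h [^]\<^bsub>A\<^esub> (- H x)"
    using uv by (simp add: letter_False A.int_pow_inv A.int_pow_neg)
  finally have "proj x u \<otimes>\<^bsub>A\<^esub> edge v u [^]\<^bsub>A\<^esub> H x
     = x \<otimes>\<^bsub>A\<^esub> ((?g [^]\<^bsub>A\<^esub> (- H x) \<otimes>\<^bsub>A\<^esub> ?g [^]\<^bsub>A\<^esub> H x) \<otimes>\<^bsub>A\<^esub> ?h [^]\<^bsub>A\<^esub> (- H x))"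
    using uv assms(1) by (simp add: proj_def A.m_assoc)
  also have "?g [^]\<^bsub>A\<^esub> (- H x) \<otimes>\<^bsub>A\<^esub> ?g [^]\<^bsub>A\<^esub> H x = \<one>\<^bsub>A\<^esub>"
    using uv A.int_pow_mult[of ?g "- H x" "H x"] by simp
  finally show ?thesis using uv assms(1) by (simp add: proj_def)
qed

end

locale connected_simple_graph = simple_graph \<Gamma> for \<Gamma> :: "'v pair_pre_digraph" +
  assumes conn_V: "conn_on V E"
begin

lemma edges_subset: "edges \<subseteq> carrier BB"
  using arc_in_V by (auto simp: edges_def)

lemma rtrancl_V: "u \<in> V \<Longrightarrow> v \<in> V \<Longrightarrow> (u, v) \<in> rtrancl_on V E"
  using conn_V by (auto simp: conn_on_def)

text \<open>A new letter does not change the projection along its own vertex. The other projections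
  are reached by walking through \<Gamma>, each step multiplying by a power of an edge element.
  Elements of \<open>BB\<close> are their own projections, which gives generation.\<close>

lemma proj_in_generate:
  assumes "x \<in> carrier A" "u \<in> V"
  shows "proj x u \<in> generate A edges"
  using assms
proof (induction x arbitrary: u rule: A_induct)
  case one
  then have "proj \<one>\<^bsub>A\<^esub> u = \<one>\<^bsub>A\<^esub>"
    using proj_BB[of "\<one>\<^bsub>A\<^esub>" u] BB.one_closed by simp
  then show ?case by (simp only: generate.one)
next
  case (step x l)
  let ?y = "x \<otimes>\<^bsub>A\<^esub> letter l"
  have gen: "edge v w [^]\<^bsub>A\<^esub> k \<in> generate A edges" if "(v, w) \<in> E" for v w and k :: int
  proof -
    interpret S: subgroup "generate A edges" A
      using edges_subset BB_in_A by (intro A.generate_is_subgroup) auto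
    have "edge v w \<in> generate A edges"
      using that by (intro generate.incl) (auto simp: edges_def)
    then show ?thesis by (rule A.subgroup_int_pow_closed[OF S.subgroup_axioms])
  qed
  have "(fst l, u) \<in> rtrancl_on V E" using step rtrancl_V by auto
  then show ?case
  proof (induction rule: rtrancl_on_induct)
    case base
    then show ?case
      using proj_mult_letter[OF step.hyps, of "snd l"] step.IH[OF step.hyps(2)]
      by (simp only: prod.collapse)
  next
    case (step v w)
    then have "proj ?y w = proj ?y v \<otimes>\<^bsub>A\<^esub> edge w v [^]\<^bsub>A\<^esub> H ?y"
      using \<open>x \<in> carrier A\<close> \<open>fst l \<in> V\<close> by (intro proj_adjacent) auto
    then show ?case
      using generate.eng[OF step.IH gen[OF arc_sym[OF step.hyps(2)], of "H ?y"]] by (simp only:)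
  qed
qed

lemma generate_edges: "generate A edges = carrier BB"
proof
  show "generate A edges \<subseteq> carrier BB"
    by (rule A.generate_subgroup_incl[OF edges_subset subgroup_BB])
  obtain u where "u \<in> V" using conn_V by (auto simp: conn_on_def)
  then show "carrier BB \<subseteq> generate A edges"
    using proj_in_generate[OF BB_in_A] proj_BB by fastforce
qed

lemma finite_generating_edges: "finite_generating_set BB edges"
proof -
  have "generate BB edges = carrier BB"
    using A.generate_consistent[OF edges_subset subgroup_BB] generate_edges
    unfolding BB_eq[symmetric] by simp
  then show ?thesis
    using finite_E edges_subset by (simp add: finite_generating_set_def edges_def)
qed

section \<open>Characters of \<open>BB\<close> as vertex functions modulo constants\<close>

definition res :: "('v \<Rightarrow> real) \<Rightarrow> 'v word set \<Rightarrow> real" where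
  "res f g = (if g \<in> carrier BB then chr f g else 0)"

lemma res_character: "res f \<in> characters BB"
  using BB.m_closed BB_in_A
  by (auto simp: characters_def hom_def res_def real_group_def chr_mult)

lemma character_eq_res:
  assumes "\<phi> \<in> characters BB"
  obtains f where "\<phi> = res f"
proof -
  have mult: "\<phi> (x \<otimes>\<^bsub>A\<^esub> y) = \<phi> x + \<phi> y" if "x \<in> carrier BB" "y \<in> carrier BB" for x y
    using assms that by (auto simp: characters_def hom_def real_group_def)
  have one: "\<phi> \<one>\<^bsub>A\<^esub> = 0"
    using mult[of "\<one>\<^bsub>A\<^esub>" "\<one>\<^bsub>A\<^esub>"] BB.one_closed by simp
  have inv: "\<phi> (inv\<^bsub>A\<^esub> x) = - \<phi> x" if "x \<in> carrier BB" for x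
    using mult[of x "inv\<^bsub>A\<^esub> x"] that BB.inv_closed[OF that] one
    by (simp add: BB_inv BB_in_A)
  obtain v0 where v0: "v0 \<in> V" using conn_V by (auto simp: conn_on_def)
  \<comment> \<open>Integrates \<phi> along edges starting at \<open>v0\<close>; the free additive
    constant is fixed by the value 0 at \<open>v0\<close>.\<close>
  define f where "f v = \<phi> (edge v0 v)" for v
  have e: "\<phi> (edge v w) = f w - f v" if "v \<in> V" "w \<in> V" for v w
    using mult[of "edge v w" "edge v0 v"] that v0 by (simp add: f_def edge_mult)
  have "\<phi> g = chr f g \<and> g \<in> carrier BB" if "g \<in> generate A edges" for g
    using that
  proof (induction rule: generate.induct)
    case one
    then show ?case using BB.one_closed by (simp add: \<open>\<phi> \<one>\<^bsub>A\<^esub> = 0\<close> chr_one)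
  next
    case (incl h)
    then show ?case using arc_in_V by (auto simp: edges_def e chr_edge)
  next
    case (inv h)
    then have "h \<in> carrier BB" "\<phi> h = chr f h"
      using arc_in_V by (auto simp: edges_def e chr_edge)
    then show ?case
      using BB.inv_closed[of h] by (simp add: BB_inv \<open>\<And>x. x \<in> carrier BB \<Longrightarrow> \<phi> (inv\<^bsub>A\<^esub> x) = - \<phi> x\<close>
          chr_inv BB_in_A)
  next
    case (eng h1 h2)
    then show ?case using BB.m_closed[of h1 h2] by (simp add: mult chr_mult BB_in_A)
  qed
  then have "\<phi> = res f"
    using assms by (auto simp: res_def generate_edges characters_def)
  then show thesis using that by blast
qed

lemma res_edge: "v \<in> V \<Longrightarrow> w \<in> V \<Longrightarrow> res f (bb_edge \<Gamma> (v, w)) = f w - f v"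
  by (simp add: bb_edge_eq res_def chr_edge)

lemma res_lin: "res (\<lambda>v. r * f v + s * g v) = (\<lambda>x. r * res f x + s * res g x)"
proof
  fix x
  show "res (\<lambda>v. r * f v + s * g v) x = r * res f x + s * res g x"
    using chr_lin[OF BB_in_A, of x r f s g] by (simp add: res_def)
qed

lemma res_shift: "res (\<lambda>v. f v + c) = res f"
proof
  fix x
  show "res (\<lambda>v. f v + c) x = res f x"
  proof (cases "x \<in> carrier BB")
    case True
    then have "x \<in> carrier A" "H x = 0" by (simp_all add: carrier_BB)
    then have "chr (\<lambda>v. f v + c) x = chr f x"
      using chr_lin[of x 1 f c "\<lambda>_. 1"] chr_const[of x] by simp
    with True show ?thesis by (simp add: res_def)
  qed (simp add: res_def)
qed

lemma res_eq_iff: "res f = res g \<longleftrightarrow> (\<forall>v\<in>V. \<forall>w\<in>V. f w - f v = g w - g v)"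
proof
  assume "res f = res g"
  then have "f w - f v = g w - g v" if "v \<in> V" "w \<in> V" for v w
    using res_edge[OF that, of f] res_edge[OF that, of g] by simp
  then show "\<forall>v\<in>V. \<forall>w\<in>V. f w - f v = g w - g v" by blast
next
  assume *: "\<forall>v\<in>V. \<forall>w\<in>V. f w - f v = g w - g v"
  obtain v0 where v0: "v0 \<in> V" using conn_V by (auto simp: conn_on_def)
  have fg: "f v = g v + (f v0 - g v0)" if "v \<in> V" for v
    using *[rule_format, OF v0 that] by linarith
  have "chr f a = chr (\<lambda>v. g v + (f v0 - g v0)) a" if "a \<in> carrier A" for a
  proof -
    obtain w where w: "w \<in> words V" "a = cl w" using \<open>a \<in> carrier A\<close> by (auto simp: carrier_A)
    have "(\<Sum>l\<leftarrow>w. val f l) = (\<Sum>l\<leftarrow>w. val (\<lambda>v. g v + (f v0 - g v0)) l)"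
    proof (intro arg_cong[of _ _ sum_list] list.map_cong0)
      fix l assume "l \<in> set w"
      then have "fst l \<in> V" using w(1) by (auto simp: words_def)
      from fg[OF this] show "val f l = val (\<lambda>v. g v + (f v0 - g v0)) l"
        by (simp add: val_def)
    qed
    with w show ?thesis by (simp add: chr_cl)
  qed
  then have "res f = res (\<lambda>v. g v + (f v0 - g v0))"
    using BB_in_A unfolding res_def by fastforce
  then show "res f = res g" by (simp only: res_shift)
qed

lemma res_eq_0_iff: "res f = (\<lambda>_. 0) \<longleftrightarrow> (\<forall>v\<in>V. \<forall>w\<in>V. f v = f w)"
proof -
  have "res (\<lambda>_. 0) = (\<lambda>_. 0)"
    using res_lin[of 0 f 0 f] by (simp only: mult_zero_left add_0)
  then have "res f = (\<lambda>_. 0) \<longleftrightarrow> (\<forall>v\<in>V. \<forall>w\<in>V. f w - f v = 0 - 0)"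
    using res_eq_iff[of f "\<lambda>_. 0"] by (simp only:)
  also have "\<dots> \<longleftrightarrow> (\<forall>v\<in>V. \<forall>w\<in>V. f v = f w)" by auto
  finally show ?thesis .
qed

end


section \<open>Characters outside the BNS-invariant\<close>

lemma char_class_eqD:
  assumes "char_class \<phi> = char_class \<psi>"
  obtains c where "c > 0" "\<psi> = (\<lambda>g. c * \<phi> g)"
proof -
  have "\<psi> \<in> char_class \<psi>"
    unfolding char_class_def by (auto intro: exI[of _ 1])
  then have "\<psi> \<in> char_class \<phi>" using assms by simp
  then show thesis using that by (auto simp: char_class_def)
qed

text \<open>Positive rescaling does not change the half-space, so the representative hidden in
  \<open>BNS\<close> may be taken to be \<phi> itself.\<close>

lemma char_class_in_BNS_iff:
  assumes "\<phi> \<in> characters G - {\<lambda>_. 0}"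
  shows "char_class \<phi> \<in> BNS G \<longleftrightarrow>
    (\<exists>S. finite_generating_set G S \<and>
      conn_on {g \<in> carrier G. \<phi> g \<ge> 0} ((parcs (cayley_graph G S))\<^sup>s))"
proof
  assume "char_class \<phi> \<in> BNS G"
  then obtain \<psi> S where \<psi>: "char_class \<phi> = char_class \<psi>" "finite_generating_set G S"
      "conn_on {g \<in> carrier G. \<psi> g \<ge> 0} ((parcs (cayley_graph G S))\<^sup>s)"
    unfolding BNS_def connected_induce_subgraph_iff by blast
  obtain c where "c > 0" "\<psi> = (\<lambda>g. c * \<phi> g)" using char_class_eqD[OF \<psi>(1)] .
  then have "{g \<in> carrier G. \<psi> g \<ge> 0} = {g \<in> carrier G. \<phi> g \<ge> 0}"
    by (simp add: zero_le_mult_iff)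
  with \<psi> show "\<exists>S. finite_generating_set G S \<and>
      conn_on {g \<in> carrier G. \<phi> g \<ge> 0} ((parcs (cayley_graph G S))\<^sup>s)" by auto
next
  assume "\<exists>S. finite_generating_set G S \<and>
      conn_on {g \<in> carrier G. \<phi> g \<ge> 0} ((parcs (cayley_graph G S))\<^sup>s)"
  then show "char_class \<phi> \<in> BNS G"
    using assms unfolding BNS_def connected_induce_subgraph_iff by blast
qed

text \<open>A translate of \<open>X\<close> by an element on which \<open>\<phi>\<close> is very negative has its coboundary inside
  the half-space where \<open>\<phi>\<close> is negative, so it disconnects the complementary half-space.\<close>

lemma half_space_not_connected:
  fixes \<phi> :: "'g \<Rightarrow> real"
  assumes G: "group G" and \<phi>: "\<phi> \<in> characters G"
    and S: "finite S" "S \<subseteq> carrier G"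
    and bdd: "\<And>s. s \<in> S \<Longrightarrow>
      \<exists>B. \<forall>g\<in>carrier G. (g \<in> X) \<noteq> (g \<otimes>\<^bsub>G\<^esub> s \<in> X) \<longrightarrow> \<phi> g \<le> B"
    and inside: "\<And>N. \<exists>p\<in>carrier G. p \<in> X \<and> N \<le> \<phi> p"
    and outside: "\<And>N. \<exists>q\<in>carrier G. q \<notin> X \<and> N \<le> \<phi> q"
  shows "\<not> conn_on {g \<in> carrier G. \<phi> g \<ge> 0} ((parcs (cayley_graph G S))\<^sup>s)"
proof
  interpret group G by (rule G)
  let ?P = "{g \<in> carrier G. \<phi> g \<ge> 0}"
  assume conn: "conn_on ?P ((parcs (cayley_graph G S))\<^sup>s)"
  have mult: "\<phi> (x \<otimes>\<^bsub>G\<^esub> y) = \<phi> x + \<phi> y" if "x \<in> carrier G" "y \<in> carrier G" for x y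
    using \<phi> that by (auto simp: characters_def hom_def real_group_def)
  obtain B where B: "\<And>s g. s \<in> S \<Longrightarrow> g \<in> carrier G \<Longrightarrow> (g \<in> X) \<noteq> (g \<otimes>\<^bsub>G\<^esub> s \<in> X) \<Longrightarrow> \<phi> g \<le> B s"
    using bdd by metis
  \<comment> \<open>Where \<phi> exceeds \<open>M\<close>, no generator crosses the boundary of
    \<open>X\<close>; inserting 0 keeps the maximum meaningful for empty \<open>S\<close>.\<close>
  define M where "M = Max (insert 0 (B ` S))"
  have M: "\<phi> g \<le> M" if "s \<in> S" "g \<in> carrier G" "(g \<in> X) \<noteq> (g \<otimes>\<^bsub>G\<^esub> s \<in> X)" for s g
  proof -
    have "B s \<le> M" unfolding M_def using S(1) that(1) by (intro Max_ge) auto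
    with B[OF that] show ?thesis by linarith
  qed
  obtain t where t: "t \<in> carrier G" "M + 1 \<le> \<phi> t" using inside by blast
  obtain p where p: "p \<in> carrier G" "p \<in> X" "\<phi> t \<le> \<phi> p" using inside by blast
  obtain q where q: "q \<in> carrier G" "q \<notin> X" "\<phi> t \<le> \<phi> q" using outside by blast
  have tt: "t \<otimes>\<^bsub>G\<^esub> (inv\<^bsub>G\<^esub> t \<otimes>\<^bsub>G\<^esub> x) = x" if "x \<in> carrier G" for x
  proof -
    have "t \<otimes>\<^bsub>G\<^esub> (inv\<^bsub>G\<^esub> t \<otimes>\<^bsub>G\<^esub> x) = (t \<otimes>\<^bsub>G\<^esub> inv\<^bsub>G\<^esub> t) \<otimes>\<^bsub>G\<^esub> x"
      using t that by (simp only: m_assoc inv_closed)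
    with t that show ?thesis by simp
  qed
  have tP: "inv\<^bsub>G\<^esub> t \<otimes>\<^bsub>G\<^esub> x \<in> ?P" if "x \<in> carrier G" "\<phi> t \<le> \<phi> x" for x
    using mult[of t "inv\<^bsub>G\<^esub> t \<otimes>\<^bsub>G\<^esub> x"] tt[OF that(1)] that t by simp
  \<comment> \<open>Multiplication by \<open>t\<close> on the left lifts the half-space above
    \<open>M\<close>, so membership of the translate in \<open>X\<close> is invariant along paths of
    the half-space.\<close>
  have "t \<otimes>\<^bsub>G\<^esub> g \<in> X \<longleftrightarrow> t \<otimes>\<^bsub>G\<^esub> (inv\<^bsub>G\<^esub> t \<otimes>\<^bsub>G\<^esub> p) \<in> X"
    if "(inv\<^bsub>G\<^esub> t \<otimes>\<^bsub>G\<^esub> p, g) \<in> rtrancl_on ?P ((parcs (cayley_graph G S))\<^sup>s)" for g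
    using that
  proof (induction rule: rtrancl_on_induct)
    case base
    show ?case by simp
  next
    case (step y z)
    have *: "t \<otimes>\<^bsub>G\<^esub> x \<in> X \<longleftrightarrow> t \<otimes>\<^bsub>G\<^esub> (x \<otimes>\<^bsub>G\<^esub> s) \<in> X" if "x \<in> ?P" "s \<in> S" for x s
    proof -
      have "s \<in> carrier G" "x \<in> carrier G" using that S by auto
      then have "t \<otimes>\<^bsub>G\<^esub> (x \<otimes>\<^bsub>G\<^esub> s) = (t \<otimes>\<^bsub>G\<^esub> x) \<otimes>\<^bsub>G\<^esub> s" "t \<otimes>\<^bsub>G\<^esub> x \<in> carrier G"
        using t by (simp_all add: m_assoc)
      moreover have "M < \<phi> (t \<otimes>\<^bsub>G\<^esub> x)"
        using mult[OF t(1) \<open>x \<in> carrier G\<close>] t(2) that(1) by simp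
      ultimately show ?thesis using M[OF that(2)] by fastforce
    qed
    have "\<exists>s\<in>S. z = y \<otimes>\<^bsub>G\<^esub> s \<or> y = z \<otimes>\<^bsub>G\<^esub> s"
      using step.hyps(2) by (auto simp: symcl_def cayley_graph_def)
    then show ?case using step.IH * step.hyps by blast
  qed
  moreover have "(inv\<^bsub>G\<^esub> t \<otimes>\<^bsub>G\<^esub> p, inv\<^bsub>G\<^esub> t \<otimes>\<^bsub>G\<^esub> q) \<in> rtrancl_on ?P ((parcs (cayley_graph G S))\<^sup>s)"
    using conn tP[OF p(1,3)] tP[OF q(1,3)] unfolding conn_on_def by blast
  ultimately show False using tt p q by fastforce
qed


context connected_simple_graph
begin

text \<open>\<open>\<Gamma> - U\<close> is the disjoint union of \<open>X\<close> and \<open>Y\<close>, and \<open>f\<close> vanishes on \<open>U\<close>. The group \<open>A\<close> acts on two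
  copies of the line: \<open>X\<close> translates both copies, \<open>U\<close> acts trivially, and \<open>Y\<close> acts by translations
  conjugated by the involution exchanging the two origins, or by this involution itself if \<open>f\<close>
  vanishes on \<open>Y\<close>. So every generator changes copies only near the origins.\<close>

definition swap :: "real \<times> bool \<Rightarrow> real \<times> bool" where
  "swap \<omega> = (if fst \<omega> = 0 then (fst \<omega>, \<not> snd \<omega>) else \<omega>)"

definition shift :: "real \<Rightarrow> real \<times> bool \<Rightarrow> real \<times> bool" where
  "shift r \<omega> = (fst \<omega> + r, snd \<omega>)"

text \<open>If \<open>f\<close> vanishes on \<open>Y\<close>, the conjugated translations would all
  be the identity and no word could change copies; hence the separate case.\<close>

definition act_letter ::
    "'v set \<Rightarrow> 'v set \<Rightarrow> ('v \<Rightarrow> real) \<Rightarrow> 'v \<times> bool \<Rightarrow> real \<times> bool \<Rightarrow> real \<times> bool" where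
  "act_letter X Y f l =
     (if fst l \<in> X then shift (val f l)
      else if fst l \<in> Y then
        (if \<forall>y\<in>Y. f y = 0 then swap else swap \<circ> shift (val f l) \<circ> swap)
      else id)"

lemma swap_swap [simp]: "swap (swap \<omega>) = \<omega>"
  by (cases \<omega>) (simp add: swap_def)

lemma fst_swap [simp]: "fst (swap \<omega>) = fst \<omega>"
  by (simp add: swap_def)

lemma shift_shift [simp]: "shift r (shift s \<omega>) = shift (s + r) \<omega>"
  by (simp add: shift_def)

lemma shift_0 [simp]: "shift 0 \<omega> = \<omega>"
  by (simp add: shift_def)

lemma act_letter_cancel: "act_letter X Y f (v, \<not> b) (act_letter X Y f (v, b) \<omega>) = \<omega>"
  by (auto simp: act_letter_def val_def)

text \<open>Letters of \<open>X\<close> are translations; letters of \<open>Y\<close> are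
  translations conjugated by one involution, or that involution itself. Only a pair across
  \<open>X\<close> and \<open>Y\<close> can fail to commute, and such vertices are not
  adjacent.\<close>

lemma act_letter_commute:
  assumes "v \<in> X \<Longrightarrow> w \<notin> Y" "v \<in> Y \<Longrightarrow> w \<notin> X"
  shows "act_letter X Y f (v, b) (act_letter X Y f (w, c) \<omega>)
     = act_letter X Y f (w, c) (act_letter X Y f (v, b) \<omega>)"
  using assms by (auto simp: act_letter_def add.commute)

text \<open>A right action: an appended letter acts last, in accordance with right multiplication in
  the Cayley graph.\<close>

definition act :: "'v set \<Rightarrow> 'v set \<Rightarrow> ('v \<Rightarrow> real) \<Rightarrow> 'v word \<Rightarrow> real \<times> bool \<Rightarrow> real \<times> bool" where
  "act X Y f w \<omega> = fold (act_letter X Y f) w \<omega>"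

lemma act_word_rel:
  assumes XY: "\<And>x y. x \<in> X \<Longrightarrow> y \<in> Y \<Longrightarrow> (x, y) \<notin> E"
  shows "(u, w) \<in> word_rel V (raag_relators \<Gamma>) \<Longrightarrow> act X Y f u \<omega> = act X Y f w \<omega>"
proof (induction arbitrary: \<omega> rule: word_rel.induct)
  case (cancel u w x b)
  then show ?case by (simp add: act_def act_letter_cancel)
next
  case (relator u w r)
  from \<open>r \<in> raag_relators \<Gamma>\<close> obtain v x where
    r: "r = [(v, True), (x, True), (v, False), (x, False)]" "(v, x) \<in> E"
    by (auto simp: raag_relators_def)
  have "v \<in> X \<Longrightarrow> x \<notin> Y" "v \<in> Y \<Longrightarrow> x \<notin> X"
    using XY r(2) arc_sym by blast+
  then have "act X Y f r \<omega> = \<omega>" for \<omega>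
    using act_letter_cancel[of X Y f v True] act_letter_cancel[of X Y f x True]
    by (simp add: act_def r(1) act_letter_commute[of v X x Y f False True])
  then show ?case by (simp add: act_def)
qed simp_all

text \<open>The set to which \<open>half_space_not_connected\<close> is applied. By
  \<open>cl_in_far_side\<close> any word of the class decides membership.\<close>

definition far_side :: "'v set \<Rightarrow> 'v set \<Rightarrow> ('v \<Rightarrow> real) \<Rightarrow> 'v word set set" where
  "far_side X Y f = {cl w | w. w \<in> words V \<and> snd (act X Y f w (0, False))}"

lemma cl_in_far_side:
  assumes "\<And>x y. x \<in> X \<Longrightarrow> y \<in> Y \<Longrightarrow> (x, y) \<notin> E" "w \<in> words V"
  shows "cl w \<in> far_side X Y f \<longleftrightarrow> snd (act X Y f w (0, False))"
proof
  assume "cl w \<in> far_side X Y f"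
  then obtain w' where w': "w' \<in> words V" "cl w = cl w'" "snd (act X Y f w' (0, False))"
    by (auto simp: far_side_def)
  have "(w, w') \<in> word_rel V (raag_relators \<Gamma>)"
    using w' assms(2) eq_equiv_class[OF _ equiv_word_rel] unfolding cl_def by fastforce
  from act_word_rel[OF assms(1) this, where f = f and \<omega> = "(0, False)"] w'(3) show "snd (act X Y f w (0, False))" by simp
qed (use assms(2) in \<open>auto simp: far_side_def\<close>)

text \<open>Swaps keep the line coordinate and \<open>f\<close> is 0 on \<open>U\<close>, so the
  coordinate records the character.\<close>

lemma fst_act:
  assumes "X \<union> Y \<union> U = V" "\<And>u. u \<in> U \<Longrightarrow> f u = 0" "w \<in> words V"
  shows "fst (act X Y f w \<omega>) = fst \<omega> + chr f (cl w)"
proof -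
  have *: "fst (act_letter X Y f l \<omega>) = fst \<omega> + val f l" if "fst l \<in> V" for l \<omega>
    using that assms(1,2) by (auto simp: act_letter_def shift_def val_def)
  have "w \<in> words V \<Longrightarrow> fst (act X Y f w \<omega>) = fst \<omega> + (\<Sum>l\<leftarrow>w. val f l)" for w \<omega>
    unfolding act_def
    by (induction w arbitrary: \<omega>) (simp_all add: *)
  then show ?thesis using assms(3) by (simp add: chr_cl)
qed

lemma snd_act_letter:
  "snd (act_letter X Y f l \<omega>) \<noteq> snd \<omega> \<Longrightarrow> fst \<omega> = 0 \<or> fst \<omega> + val f l = 0"
  by (auto simp: act_letter_def shift_def swap_def split: if_splits)

text \<open>A letter changes copies only if the position, which is \<open>chr f g\<close>, is at 0
  before or after it. In a product the change occurs at \<open>a\<close> or at the last letter,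
  whose starting position is displaced by \<open>chr f a\<close>.\<close>

lemma far_side_coboundary:
  assumes XY: "\<And>x y. x \<in> X \<Longrightarrow> y \<in> Y \<Longrightarrow> (x, y) \<notin> E"
    and V: "X \<union> Y \<union> U = V" and fU: "\<And>u. u \<in> U \<Longrightarrow> f u = 0" and a: "a \<in> carrier A"
  shows "\<exists>B. \<forall>g\<in>carrier A. (g \<in> far_side X Y f) \<noteq> (g \<otimes>\<^bsub>A\<^esub> a \<in> far_side X Y f) \<longrightarrow> chr f g \<le> B"
  using a
proof (induction rule: A_induct)
  case one
  then show ?case by simp
next
  case (step a l)
  let ?X = "far_side X Y f"
  obtain B where B: "\<And>g. g \<in> carrier A \<Longrightarrow> (g \<in> ?X) \<noteq> (g \<otimes>\<^bsub>A\<^esub> a \<in> ?X) \<Longrightarrow> chr f g \<le> B"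
    using step.IH by blast
  have l: "chr f g \<le> \<bar>val f l\<bar>"
    if g: "g \<in> carrier A" and ne: "(g \<in> ?X) \<noteq> (g \<otimes>\<^bsub>A\<^esub> letter l \<in> ?X)" for g
  proof -
    obtain w where w: "w \<in> words V" "g = cl w" using g by (auto simp: carrier_A)
    have lV: "w @ [l] \<in> words V" using w step.hyps by simp
    have "g \<otimes>\<^bsub>A\<^esub> letter l = cl (w @ [l])" using w step.hyps by (simp add: cl_snoc)
    with ne have "snd (act X Y f w (0, False)) \<noteq> snd (act X Y f (w @ [l]) (0, False))"
      unfolding w(2) using cl_in_far_side[OF XY w(1), where f = f] cl_in_far_side[OF XY lV, where f = f] by simp
    moreover have "act X Y f (w @ [l]) (0, False) = act_letter X Y f l (act X Y f w (0, False))"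
      by (simp add: act_def)
    ultimately have "fst (act X Y f w (0, False)) = 0 \<or> fst (act X Y f w (0, False)) + val f l = 0"
      using snd_act_letter by metis
    moreover have "fst (act X Y f w (0, False)) = chr f g"
      using fst_act[OF V fU w(1), where \<omega> = "(0, False)"] w(2) by simp
    ultimately show ?thesis by linarith
  qed
  have "chr f g \<le> max B (\<bar>val f l\<bar> - chr f a)"
    if g: "g \<in> carrier A" "(g \<in> ?X) \<noteq> (g \<otimes>\<^bsub>A\<^esub> (a \<otimes>\<^bsub>A\<^esub> letter l) \<in> ?X)" for g
  proof (cases "(g \<in> ?X) \<noteq> (g \<otimes>\<^bsub>A\<^esub> a \<in> ?X)")
    case True
    from B[OF g(1) this] show ?thesis by linarith
  next
    case False
    have "g \<otimes>\<^bsub>A\<^esub> (a \<otimes>\<^bsub>A\<^esub> letter l) = g \<otimes>\<^bsub>A\<^esub> a \<otimes>\<^bsub>A\<^esub> letter l"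
      using g(1) step.hyps by (simp add: A.m_assoc)
    with g(2) False have "(g \<otimes>\<^bsub>A\<^esub> a \<in> ?X) \<noteq> (g \<otimes>\<^bsub>A\<^esub> a \<otimes>\<^bsub>A\<^esub> letter l \<in> ?X)" by simp
    from l[OF _ this] g(1) step.hyps have "chr f (g \<otimes>\<^bsub>A\<^esub> a) \<le> \<bar>val f l\<bar>" by simp
    moreover have "chr f (g \<otimes>\<^bsub>A\<^esub> a) = chr f g + chr f a"
      by (rule chr_mult[OF g(1) step.hyps(1)])
    ultimately show ?thesis by linarith
  qed
  then show ?case by blast
qed

lemma cl_in_BB: "w \<in> words V \<Longrightarrow> exponent_sum w = 0 \<Longrightarrow> cl w \<in> carrier BB"
  by (simp add: carrier_BB height_cl)

lemma not_in_BNS_of_parts: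
  assumes XY: "\<And>x y. x \<in> X \<Longrightarrow> y \<in> Y \<Longrightarrow> (x, y) \<notin> E"
    and V: "X \<union> Y \<union> U = V" and fU: "\<And>u. u \<in> U \<Longrightarrow> f u = 0"
    and disj: "X \<inter> Y = {}" "U \<inter> (X \<union> Y) = {}"
    and x: "x \<in> X" "f x \<noteq> 0" and Y: "Y \<noteq> {}" and u: "u \<in> U"
  shows "char_class (res f) \<notin> BNS BB"
proof -
  let ?X = "far_side X Y f"
  \<comment> \<open>If possible, \<open>f y\<close> is nonzero: then the point is moved off the
    origin between the two swaps and the second swap does not undo the first.\<close>
  obtain y where y: "y \<in> Y" "(\<forall>y\<in>Y. f y = 0) \<or> f y \<noteq> 0" using Y by blast
  have xyu: "x \<in> V" "y \<in> V" "u \<in> V" "y \<notin> X" "u \<notin> X" "u \<notin> Y" using x y u V disj by auto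
  \<comment> \<open>The sign is chosen so that each repetition climbs by
    \<open>\<bar>f x\<bar>\<close>. The letter of \<open>u\<close> restores height 0 and acts
    trivially, so these words climb in the first copy.\<close>
  define b where "b \<longleftrightarrow> f x > 0"
  define w where "w n = concat (replicate n [(x, b), (u, \<not> b)])" for n :: nat
  have w: "w n \<in> words V" "exponent_sum (w n) = 0" for n
    using xyu by (induction n) (auto simp: w_def exponent_sum_append exponent_sum_def)
  have act_w: "act X Y f (w n) \<omega> = shift (n * \<bar>f x\<bar>) \<omega>" for n \<omega>
  proof (induction n arbitrary: \<omega>)
    case 0
    then show ?case by (simp add: w_def act_def)
  next
    case (Suc n)
    have "act X Y f (w (Suc n)) \<omega> = act X Y f (w n) (shift \<bar>f x\<bar> \<omega>)"
      using x xyu by (simp add: w_def act_def act_letter_def val_def b_def abs_if)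
    then show ?case using Suc by (simp add: algebra_simps)
  qed
  \<comment> \<open>Crosses to the second copy at the origin, again with \<open>u\<close> correcting
    the height; appending \<open>w n\<close> then climbs there.\<close>
  let ?p = "[(y, True), (u, False)]"
  have p: "?p @ w n \<in> words V" "exponent_sum (?p @ w n) = 0" for n
    using w xyu by (simp_all add: exponent_sum_append) (simp add: exponent_sum_def)
  have act_p: "act X Y f ?p (0, False) = (f y, True)"
    using xyu y by (auto simp: act_def act_letter_def val_def swap_def shift_def)
  have act_pw: "act X Y f (?p @ w n) (0, False) = (f y + n * \<bar>f x\<bar>, True)" for n
  proof -
    have "act X Y f (?p @ w n) (0, False) = act X Y f (w n) (act X Y f ?p (0, False))"
      by (simp add: act_def)
    then show ?thesis unfolding act_p act_w by (simp add: shift_def)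
  qed
  have res_cl: "res f (cl v) = fst (act X Y f v (0, False))" "cl v \<in> carrier BB"
    if "v \<in> words V" "exponent_sum v = 0" for v
    using cl_in_BB[OF that] fst_act[OF V fU that(1), where \<omega> = "(0, False)"] by (simp_all add: res_def)
  have arch: "\<exists>n. N \<le> c + real n * \<bar>f x\<bar>" for N c
  proof -
    obtain n where "(N - c) / \<bar>f x\<bar> \<le> real n" using real_arch_simple by blast
    then have "N \<le> c + real n * \<bar>f x\<bar>" using x(2) by (simp add: pos_divide_le_eq)
    then show ?thesis by blast
  qed
  have disc: "\<not> conn_on {g \<in> carrier BB. res f g \<ge> 0} ((parcs (cayley_graph BB S))\<^sup>s)"
    if S: "finite_generating_set BB S" for S
  proof (rule half_space_not_connected[OF BB.group_axioms res_character, where X = ?X])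
    show "finite S" "S \<subseteq> carrier BB" using S by (auto simp: finite_generating_set_def)
    fix s assume "s \<in> S"
    then have "s \<in> carrier A" using S BB_in_A by (auto simp: finite_generating_set_def)
    have "\<exists>B. \<forall>g\<in>carrier A. (g \<in> ?X) \<noteq> (g \<otimes>\<^bsub>A\<^esub> s \<in> ?X) \<longrightarrow> chr f g \<le> B"
      by (rule far_side_coboundary[where U = U]) (fact XY V fU \<open>s \<in> carrier A\<close>)+
    then obtain B where B: "\<And>g. g \<in> carrier A \<Longrightarrow> (g \<in> ?X) \<noteq> (g \<otimes>\<^bsub>A\<^esub> s \<in> ?X) \<Longrightarrow> chr f g \<le> B"
      by blast
    show "\<exists>B. \<forall>g\<in>carrier BB. (g \<in> ?X) \<noteq> (g \<otimes>\<^bsub>BB\<^esub> s \<in> ?X) \<longrightarrow> res f g \<le> B"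
    proof (intro exI ballI impI)
      fix g assume "g \<in> carrier BB" "(g \<in> ?X) \<noteq> (g \<otimes>\<^bsub>BB\<^esub> s \<in> ?X)"
      then have "chr f g \<le> B" by (intro B BB_in_A) simp_all
      then show "res f g \<le> B" using \<open>g \<in> carrier BB\<close> by (simp add: res_def)
    qed
  next
    fix N
    obtain n where "N \<le> f y + real n * \<bar>f x\<bar>" using arch by blast
    then show "\<exists>q\<in>carrier BB. q \<in> ?X \<and> N \<le> res f q"
      using res_cl[OF p] act_pw cl_in_far_side[OF XY p(1), where f = f]
      by (intro bexI[of _ "cl (?p @ w n)"]) simp_all
  next
    fix N
    obtain n where "N \<le> 0 + real n * \<bar>f x\<bar>" using arch by blast
    then show "\<exists>q\<in>carrier BB. q \<notin> ?X \<and> N \<le> res f q"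
      using res_cl[OF w] act_w cl_in_far_side[OF XY w(1), where f = f]
      by (intro bexI[of _ "cl (w n)"]) (simp_all add: shift_def)
  qed
  have "res f \<noteq> (\<lambda>_. 0)"
  proof
    assume "res f = (\<lambda>_. 0)"
    then have "f x = f u" unfolding res_eq_0_iff using xyu(1,3) by blast
    then show False using x(2) fU[OF u] by simp
  qed
  then have "res f \<in> characters BB - {\<lambda>_. 0}"
    using res_character by blast
  from char_class_in_BNS_iff[OF this] disc show ?thesis by blast
qed

lemma sepset_nonempty: "sepset U \<Longrightarrow> U \<noteq> {}"
  using conn_V by (auto simp: sepset_def)

lemma not_in_BNS:
  assumes U: "sepset U" and f: "\<And>u v. u \<in> U \<Longrightarrow> v \<in> U \<Longrightarrow> f u = f v"
    and nz: "res f \<noteq> (\<lambda>_. 0)"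
  shows "char_class (res f) \<notin> BNS BB"
proof -
  obtain u where u: "u \<in> U" using sepset_nonempty[OF U] by blast
  have UV: "U \<subseteq> V" using U by (auto simp: sepset_def)
  define f' where "f' v = f v + (- f u)" for v
  have res: "res f' = res f" unfolding f'_def by (rule res_shift)
  have f'U: "f' v = 0" if "v \<in> U" for v using f[OF that u] by (simp add: f'_def)
  obtain a b where ab: "a \<in> V - U" "b \<in> V - U" "(a, b) \<notin> rtrancl_on (V - U) E"
    using sepset_parts[OF U] .
  define X where "X = {x. (a, x) \<in> rtrancl_on (V - U) E}"
  define Y where "Y = V - U - X"
  have XV: "X \<subseteq> V - U" unfolding X_def using in_rtrancl_on_in_F by fastforce
  have aX: "a \<in> X" and bY: "b \<in> Y" using ab by (auto simp: X_def Y_def)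
  have XY: "(x, y) \<notin> E" if "x \<in> X" "y \<in> Y" for x y
    using that by (auto simp: X_def Y_def dest: rtrancl_on_into_rtrancl_on)
  then have YX: "(y, x) \<notin> E" if "y \<in> Y" "x \<in> X" for x y
    using that arc_sym by blast
  obtain z where z: "z \<in> V" "f' z \<noteq> 0"
    using nz res_eq_0_iff[of f'] unfolding res by force
  then have "z \<in> X \<or> z \<in> Y" using f'U by (auto simp: Y_def)
  \<comment> \<open>The part containing \<open>z\<close> must be the one that acts by plain
    translations, so the roles of \<open>X\<close> and \<open>Y\<close> are exchanged if
    necessary.\<close>
  then have "char_class (res f') \<notin> BNS BB"
  proof
    assume zX: "z \<in> X"
    show ?thesis
      by (rule not_in_BNS_of_parts[where X = X and Y = Y and U = U and x = z and u = u])
        (use XV UV bY z zX u XY f'U in \<open>auto simp: Y_def\<close>)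
  next
    assume zY: "z \<in> Y"
    show ?thesis
      by (rule not_in_BNS_of_parts[where X = Y and Y = X and U = U and x = z and u = u])
        (use XV UV aX z zY u YX f'U in \<open>auto simp: Y_def\<close>)
  qed
  then show ?thesis unfolding res .
qed

end


section \<open>Characters in the BNS-invariant\<close>

locale no_level_separation = connected_simple_graph \<Gamma> for \<Gamma> :: "'v pair_pre_digraph" +
  fixes f :: "'v \<Rightarrow> real" and \<eta> :: real
  assumes \<eta>_pos: "0 < \<eta>"
    and gap: "\<And>v w. v \<in> V \<Longrightarrow> w \<in> V \<Longrightarrow> f v \<noteq> f w \<Longrightarrow> 2 * \<eta> \<le> \<bar>f v - f w\<bar>"
    and nonconst: "\<exists>v\<in>V. \<exists>w\<in>V. f v \<noteq> f w"
    and no_sep: "\<And>U. sepset U \<Longrightarrow> \<exists>u\<in>U. \<exists>v\<in>U. f u \<noteq> f v"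
begin

section \<open>Vertices away from a level\<close>

definition alive :: "real \<Rightarrow> real \<Rightarrow> 'v set" where
  "alive \<tau> c = {v \<in> V. \<tau> \<le> \<bar>f v - c\<bar>}"

lemma dead_level:
  assumes "\<tau> \<le> \<eta>" "u \<in> V - alive \<tau> c" "v \<in> V - alive \<tau> c"
  shows "f u = f v"
proof (rule ccontr)
  assume ne: "f u \<noteq> f v"
  have uv: "u \<in> V" "v \<in> V" using assms by auto
  have "\<bar>f u - c\<bar> < \<tau>" "\<bar>f v - c\<bar> < \<tau>" using assms by (auto simp: alive_def)
  with gap[OF uv ne] \<open>\<tau> \<le> \<eta>\<close> show False by linarith
qed

lemma alive_nonempty:
  assumes "\<tau> \<le> \<eta>"
  shows "alive \<tau> c \<noteq> {}"
proof
  assume "alive \<tau> c = {}"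
  then have "f u = f v" if "u \<in> V" "v \<in> V" for u v
    using dead_level[OF assms, of u c v] that by simp
  with nonconst show False by blast
qed

lemma not_sepset_dead:
  assumes "\<tau> \<le> \<eta>" "U \<subseteq> V - alive \<tau> c"
  shows "\<not> sepset U"
  using no_sep[of U] dead_level[OF assms(1)] assms(2) by blast

text \<open>The discarded vertices lie in one level set, so removing them cannot disconnect the
  graph. Two thresholds will be used: \<eta> / 2 for the letters that count as uphill at an element,
  \<eta> for those that remain uphill after one step.\<close>

lemma conn_alive:
  assumes "\<tau> \<le> \<eta>"
  shows "conn_on (alive \<tau> c) E"
proof -
  have "V - (V - alive \<tau> c) = alive \<tau> c" by (auto simp: alive_def)
  then show ?thesis
    using not_sepset_dead[OF assms subset_refl, of c] alive_nonempty[OF assms, of c]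
    by (auto simp: sepset_def)
qed

text \<open>Otherwise all neighbours of \<open>v\<close> would lie in one level set and would
  separate \<open>v\<close> from the alive vertices.\<close>

lemma alive_dominating:
  assumes "\<tau> \<le> \<eta>" "v \<in> V" "v \<notin> alive \<tau> c"
  obtains w where "w \<in> alive \<tau> c" "(v, w) \<in> E"
proof (rule ccontr)
  assume *: "\<not> thesis"
  let ?L = "{w. (v, w) \<in> E}"
  have L: "?L \<subseteq> V - alive \<tau> c" using * that arc_in_V by auto
  obtain w where w: "w \<in> alive \<tau> c" using alive_nonempty[OF assms(1)] by blast
  have "x = v" if "(v, x) \<in> rtrancl_on (V - ?L) E" for x
    using that by (induction rule: rtrancl_on_induct) auto
  moreover have "w \<in> V - ?L" "v \<in> V - ?L" "w \<noteq> v"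
    using w L assms no_loop by (auto simp: alive_def)
  ultimately have "\<not> conn_on (V - ?L) E"
    unfolding conn_on_def by blast
  then have "sepset ?L"
    using L \<open>w \<in> V - ?L\<close> unfolding sepset_def by blast
  with not_sepset_dead[OF assms(1) L] show False by simp
qed

definition \<kappa> :: real where "\<kappa> = \<eta> / 8"

text \<open>\<open>pot\<close> plays the role of a smoothed distance to the ray \<open>H = 0, chr f \<ge> 0\<close> in the plane: it is
  raised at \<open>x\<close> by the letters on which the character \<open>f - slope x \<cdot> H\<close> is large.\<close>

definition pot :: "'v word set \<Rightarrow> real" where
  "pot x = chr f x - \<kappa> * (real_of_int (H x))\<^sup>2"

definition slope :: "'v word set \<Rightarrow> real" where
  "slope x = 2 * \<kappa> * real_of_int (H x)"

definition sg :: "bool \<Rightarrow> real" where "sg b = (if b then 1 else - 1)"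

definition up :: "'v word set \<Rightarrow> 'v \<Rightarrow> 'v \<times> bool" where
  "up x v = (v, slope x < f v)"

lemma fst_up [simp]: "fst (up x v) = v"
  by (simp add: up_def)

definition alive_at :: "'v word set \<Rightarrow> 'v set" where
  "alive_at x = alive (\<eta> / 2) (slope x)"

lemma alive_at_V: "v \<in> alive_at x \<Longrightarrow> v \<in> V"
  by (simp add: alive_at_def alive_def)

lemma H_step: "x \<in> carrier A \<Longrightarrow> v \<in> V \<Longrightarrow> real_of_int (H (x \<otimes>\<^bsub>A\<^esub> letter (v, b))) = H x + sg b"
  by (simp add: height_mult height_letter sg_def)

lemma slope_step:
  "x \<in> carrier A \<Longrightarrow> v \<in> V \<Longrightarrow> slope (x \<otimes>\<^bsub>A\<^esub> letter (v, b)) = slope x + 2 * \<kappa> * sg b"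
  unfolding slope_def by (simp only: H_step distrib_left)

text \<open>The cross term of the square turns \<open>f v\<close> into \<open>f v - slope x\<close>;
  the remaining \<kappa> is lost in either direction.\<close>

lemma pot_step:
  assumes "x \<in> carrier A" "v \<in> V"
  shows "pot (x \<otimes>\<^bsub>A\<^esub> letter (v, b)) = pot x + sg b * (f v - slope x) - \<kappa>"
proof -
  have "chr f (x \<otimes>\<^bsub>A\<^esub> letter (v, b)) = chr f x + sg b * f v"
    using assms by (simp add: chr_mult chr_letter val_def sg_def)
  moreover have "(H x + sg b)\<^sup>2 = (real_of_int (H x))\<^sup>2 + 2 * sg b * H x + 1"
    by (simp add: power2_eq_square sg_def algebra_simps)
  ultimately show ?thesis
    unfolding pot_def slope_def H_step[OF assms] by (simp add: algebra_simps)
qed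

lemma pot_up:
  assumes "x \<in> carrier A" "v \<in> V"
  shows "pot (x \<otimes>\<^bsub>A\<^esub> letter (up x v)) = pot x + \<bar>f v - slope x\<bar> - \<kappa>"
  unfolding up_def pot_step[OF assms] by (simp add: sg_def)

lemma pot_up_alive:
  assumes "x \<in> carrier A" "v \<in> alive_at x"
  shows "pot x + \<eta> / 4 \<le> pot (x \<otimes>\<^bsub>A\<^esub> letter (up x v))"
  using assms(2) pot_up[OF assms(1) alive_at_V[OF assms(2)]] \<eta>_pos
  by (simp add: alive_at_def alive_def \<kappa>_def)

section \<open>Pushing paths uphill in the Artin group\<close>

definition cay :: "'v word set rel" where
  "cay = {(x, x \<otimes>\<^bsub>A\<^esub> letter l) | x l. x \<in> carrier A \<and> fst l \<in> V}"

definition joined :: "real \<Rightarrow> 'v word set rel" where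
  "joined m = rtrancl_on {x \<in> carrier A. m \<le> pot x} cay"

lemma letter_back:
  assumes "x \<in> carrier A" "v \<in> V"
  shows "x \<otimes>\<^bsub>A\<^esub> letter (v, b) \<otimes>\<^bsub>A\<^esub> letter (v, \<not> b) = x"
  using assms letter_cancel[of v b] by (simp add: A.m_assoc)

lemma sym_cay: "sym cay"
proof (rule symI)
  fix x y assume "(x, y) \<in> cay"
  then obtain v b where *: "y = x \<otimes>\<^bsub>A\<^esub> letter (v, b)" "x \<in> carrier A" "v \<in> V"
    by (auto simp: cay_def)
  then have "x = y \<otimes>\<^bsub>A\<^esub> letter (v, \<not> b)" "y \<in> carrier A" using letter_back by simp_all
  then show "(y, x) \<in> cay" using * unfolding cay_def by (metis (mono_tags, lifting) CollectI fst_conv)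
qed

lemma joined_sym: "(x, y) \<in> joined m \<Longrightarrow> (y, x) \<in> joined m"
  unfolding joined_def by (rule rtrancl_on_sym'[OF sym_cay])

lemma joined_trans: "(x, y) \<in> joined m \<Longrightarrow> (y, z) \<in> joined m \<Longrightarrow> (x, z) \<in> joined m"
  unfolding joined_def by (rule rtrancl_on_trans)

lemma joined_mono: "(x, y) \<in> joined m \<Longrightarrow> m' \<le> m \<Longrightarrow> (x, y) \<in> joined m'"
  unfolding joined_def by (rule rtrancl_on_mono[where U = "{x \<in> carrier A. m \<le> pot x}"]) auto

lemma joined_letter:
  assumes "x \<in> carrier A" "fst l \<in> V" "m \<le> pot x" "m \<le> pot (x \<otimes>\<^bsub>A\<^esub> letter l)"
  shows "(x, x \<otimes>\<^bsub>A\<^esub> letter l) \<in> joined m"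
  unfolding joined_def
proof (rule rtrancl_on_arc)
  show "(x, x \<otimes>\<^bsub>A\<^esub> letter l) \<in> cay" using assms unfolding cay_def by blast
qed (use assms in simp_all)

text \<open>The two commuting letters span a square at \<open>x\<close>; the path runs through its
  far corner, which is still above the raised level.\<close>

lemma joined_up_adjacent:
  assumes x: "x \<in> carrier A" "m \<le> pot x"
    and vw: "v \<in> alive_at x" "w \<in> alive_at x" "(v, w) \<in> E"
  shows "(x \<otimes>\<^bsub>A\<^esub> letter (up x v), x \<otimes>\<^bsub>A\<^esub> letter (up x w)) \<in> joined (m + \<eta> / 4)"
proof -
  have V: "v \<in> V" "w \<in> V" using vw alive_at_V by auto
  let ?v = "letter (up x v)" and ?w = "letter (up x w)"
  let ?b = "slope x < f v" and ?c = "slope x < f w"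
  have cl: "x \<otimes>\<^bsub>A\<^esub> ?v \<in> carrier A" "x \<otimes>\<^bsub>A\<^esub> ?w \<in> carrier A" using x(1) V by simp_all
  have "?v \<otimes>\<^bsub>A\<^esub> ?w = ?w \<otimes>\<^bsub>A\<^esub> ?v" unfolding up_def by (rule letter_commute[OF vw(3)])
  then have comm: "x \<otimes>\<^bsub>A\<^esub> ?v \<otimes>\<^bsub>A\<^esub> ?w = x \<otimes>\<^bsub>A\<^esub> ?w \<otimes>\<^bsub>A\<^esub> ?v"
    using x(1) V by (simp add: A.m_assoc)
  have pv: "m + \<eta> / 4 \<le> pot (x \<otimes>\<^bsub>A\<^esub> ?v)" "m + \<eta> / 4 \<le> pot (x \<otimes>\<^bsub>A\<^esub> ?w)"
    using pot_up_alive[OF x(1)] vw x(2) by fastforce+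
  have "pot (x \<otimes>\<^bsub>A\<^esub> ?v \<otimes>\<^bsub>A\<^esub> ?w) = pot (x \<otimes>\<^bsub>A\<^esub> ?v) + sg ?c * (f w - (slope x + 2 * \<kappa> * sg ?b)) - \<kappa>"
    using pot_step[OF cl(1) V(2), of ?c] slope_step[OF x(1) V(1), of ?b] unfolding up_def by simp
  \<comment> \<open>The first letter moves the slope by \<open>2 * \<kappa>\<close>. Counting also
    the loss \<kappa>, the second letter still gains at least
    \<open>\<eta> / 2 - 3 * \<kappa> = \<eta> / 8\<close>.\<close>
  moreover have "sg ?c * (f w - (slope x + 2 * \<kappa> * sg ?b)) \<ge> \<bar>f w - slope x\<bar> - 2 * \<kappa>"
    using \<eta>_pos unfolding \<kappa>_def by (cases ?b; cases ?c) (simp_all add: sg_def)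
  moreover have "\<eta> / 2 \<le> \<bar>f w - slope x\<bar>"
    using vw(2) by (simp add: alive_at_def alive_def)
  ultimately have p2: "m + \<eta> / 4 \<le> pot (x \<otimes>\<^bsub>A\<^esub> ?v \<otimes>\<^bsub>A\<^esub> ?w)"
    using pv(1) \<eta>_pos unfolding \<kappa>_def by linarith
  have "(x \<otimes>\<^bsub>A\<^esub> ?v, x \<otimes>\<^bsub>A\<^esub> ?v \<otimes>\<^bsub>A\<^esub> ?w) \<in> joined (m + \<eta> / 4)"
    using cl V pv p2 by (intro joined_letter) simp_all
  moreover have "(x \<otimes>\<^bsub>A\<^esub> ?w, x \<otimes>\<^bsub>A\<^esub> ?w \<otimes>\<^bsub>A\<^esub> ?v) \<in> joined (m + \<eta> / 4)"
    using cl V pv p2 unfolding comm by (intro joined_letter) simp_all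
  ultimately show ?thesis unfolding comm using joined_trans joined_sym by blast
qed

lemma joined_up:
  assumes x: "x \<in> carrier A" "m \<le> pot x" and vw: "v \<in> alive_at x" "w \<in> alive_at x"
  shows "(x \<otimes>\<^bsub>A\<^esub> letter (up x v), x \<otimes>\<^bsub>A\<^esub> letter (up x w)) \<in> joined (m + \<eta> / 4)"
proof -
  have "(v, w) \<in> rtrancl_on (alive_at x) E"
    using conn_alive[of "\<eta> / 2" "slope x"] vw \<eta>_pos by (simp add: conn_on_def alive_at_def)
  then show ?thesis
  proof (induction rule: rtrancl_on_induct)
    case base
    have "m + \<eta> / 4 \<le> pot (x \<otimes>\<^bsub>A\<^esub> letter (up x v))"
      using pot_up_alive[OF x(1) base] x(2) by linarith
    then show ?case
      using x alive_at_V[OF base] unfolding joined_def by (intro rtrancl_on_refl) simp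
  next
    case (step y z)
    then show ?case using joined_up_adjacent[OF x step.hyps(3,4,2)] joined_trans by blast
  qed
qed

lemma alive_at_nonempty: "\<exists>v. v \<in> alive_at x"
  using alive_nonempty[of "\<eta> / 2"] \<eta>_pos by (force simp: alive_at_def)

lemma joined_self_up:
  assumes "x \<in> carrier A" "m \<le> pot x" "v \<in> alive_at x"
  shows "(x, x \<otimes>\<^bsub>A\<^esub> letter (up x v)) \<in> joined m"
  using assms alive_at_V[OF assms(3)] pot_up_alive[OF assms(1,3)] \<eta>_pos
  by (intro joined_letter) simp_all

text \<open>Lifts one arc of a path. If \<open>v\<close> is alive, the arc is itself uphill or
  downhill and its upper end already lies above the raised level. Otherwise a neighbour of
  \<open>v\<close> that is uphill at both ends carries the arc to the opposite side of a commuting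
  square.\<close>

lemma joined_up_step:
  assumes x: "x \<in> carrier A" "m \<le> pot x" and v: "v \<in> V"
    and y: "y = x \<otimes>\<^bsub>A\<^esub> letter (v, b)" "m \<le> pot y"
  shows "\<exists>u\<in>alive_at x. \<exists>w\<in>alive_at y.
    (x \<otimes>\<^bsub>A\<^esub> letter (up x u), y \<otimes>\<^bsub>A\<^esub> letter (up y w)) \<in> joined (m + \<eta> / 4)"
proof -
  have yA: "y \<in> carrier A" using x v y by simp
  have sl: "slope y = slope x + 2 * \<kappa> * sg b" using slope_step[OF x(1) v] y(1) by simp
  have near: "\<bar>slope y - slope x\<bar> \<le> \<eta> / 4"
    unfolding sl using \<eta>_pos by (simp add: sg_def \<kappa>_def)
  \<comment> \<open>The slope moves by at most \<eta> / 4 along the arc, so threshold \<eta> at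
    \<open>x\<close> leaves at least \<eta> / 2 at \<open>y\<close> without a change of
    sign.\<close>
  have stable: "w \<in> alive_at y \<and> w \<in> alive_at x \<and> up y w = up x w"
    if "w \<in> alive \<eta> (slope x)" for w
  proof -
    have w: "w \<in> V" "\<eta> \<le> \<bar>f w - slope x\<bar>" using that by (simp_all add: alive_def)
    have w2: "\<eta> / 2 \<le> \<bar>f w - slope x\<bar>" using w(2) \<eta>_pos by linarith
    have w3: "\<eta> / 2 \<le> \<bar>f w - slope y\<bar>" using w(2) near \<eta>_pos by linarith
    have "(slope y < f w) = (slope x < f w)"
    proof (cases "slope x < f w")
      case True
      then have "slope y < f w" using w(2) near \<eta>_pos by linarith
      with True show ?thesis by blast
    next
      case False
      then have "\<not> slope y < f w" using w(2) near \<eta>_pos by linarith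
      with False show ?thesis by blast
    qed
    then have "up y w = up x w" by (simp only: up_def)
    with w(1) w2 w3 show ?thesis unfolding alive_at_def alive_def by blast
  qed
  show ?thesis
  proof (cases "v \<in> alive \<eta> (slope x)")
    case True
    note v_al = stable[OF True]
    show ?thesis
    proof (cases "b \<longleftrightarrow> slope x < f v")
      case up: True
      have yup: "y = x \<otimes>\<^bsub>A\<^esub> letter (up x v)" unfolding y(1) up_def up ..
      obtain w where w: "w \<in> alive_at y" using alive_at_nonempty by blast
      have "m + \<eta> / 4 \<le> pot y"
        using pot_up_alive[OF x(1), of v] v_al x(2) unfolding yup by linarith
      from joined_self_up[OF yA this w] w v_al show ?thesis unfolding yup by blast
    next
      case down: False
      have xup: "y \<otimes>\<^bsub>A\<^esub> letter (up y v) = x"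
      proof -
        have "up y v = (v, \<not> b)" using v_al down by (auto simp: up_def)
        then have "y \<otimes>\<^bsub>A\<^esub> letter (up y v) = x \<otimes>\<^bsub>A\<^esub> letter (v, b) \<otimes>\<^bsub>A\<^esub> letter (v, \<not> b)"
          by (simp only: y(1))
        then show ?thesis by (simp only: letter_back[OF x(1) v])
      qed
      obtain w where w: "w \<in> alive_at x" using alive_at_nonempty by blast
      have "m + \<eta> / 4 \<le> pot x"
        using pot_up_alive[OF yA, of v] v_al y(2) unfolding xup by linarith
      from joined_sym[OF joined_self_up[OF x(1) this w]]
      have "(x \<otimes>\<^bsub>A\<^esub> letter (up x w), y \<otimes>\<^bsub>A\<^esub> letter (up y v)) \<in> joined (m + \<eta> / 4)"
        unfolding xup .
      with w v_al show ?thesis by blast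
    qed
  next
    case False
    obtain w where w: "w \<in> alive \<eta> (slope x)" "(v, w) \<in> E"
      using alive_dominating[OF order_refl v False] .
    note w_al = stable[OF w(1)]
    have wV: "w \<in> V" using w arc_in_V by blast
    let ?l = "letter (up x w)"
    have "letter (v, b) \<otimes>\<^bsub>A\<^esub> ?l = ?l \<otimes>\<^bsub>A\<^esub> letter (v, b)"
      unfolding up_def by (rule letter_commute[OF w(2)])
    then have yl: "y \<otimes>\<^bsub>A\<^esub> letter (up y w) = x \<otimes>\<^bsub>A\<^esub> ?l \<otimes>\<^bsub>A\<^esub> letter (v, b)"
    proof -
      assume comm: "letter (v, b) \<otimes>\<^bsub>A\<^esub> ?l = ?l \<otimes>\<^bsub>A\<^esub> letter (v, b)"
      have "y \<otimes>\<^bsub>A\<^esub> letter (up y w) = x \<otimes>\<^bsub>A\<^esub> letter (v, b) \<otimes>\<^bsub>A\<^esub> ?l"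
        using w_al by (simp only: y(1))
      also have "\<dots> = x \<otimes>\<^bsub>A\<^esub> (letter (v, b) \<otimes>\<^bsub>A\<^esub> ?l)"
        using x(1) v wV by (intro A.m_assoc) simp_all
      also have "\<dots> = x \<otimes>\<^bsub>A\<^esub> ?l \<otimes>\<^bsub>A\<^esub> letter (v, b)"
        unfolding comm using x(1) v wV by (intro A.m_assoc[symmetric]) simp_all
      finally show ?thesis .
    qed
    have "m + \<eta> / 4 \<le> pot (x \<otimes>\<^bsub>A\<^esub> ?l)" "m + \<eta> / 4 \<le> pot (y \<otimes>\<^bsub>A\<^esub> letter (up y w))"
      using pot_up_alive[OF x(1), of w] pot_up_alive[OF yA, of w] w_al x(2) y(2) by linarith+
    then have "(x \<otimes>\<^bsub>A\<^esub> ?l, y \<otimes>\<^bsub>A\<^esub> letter (up y w)) \<in> joined (m + \<eta> / 4)"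
      unfolding yl using x(1) v wV by (intro joined_letter) simp_all
    then show ?thesis using w_al by blast
  qed
qed

text \<open>Lifts of consecutive arcs may end at different uphill neighbours of their common
  element; \<open>joined_up\<close> connects them, whence the quantification over all uphill
  letters.\<close>

lemma joined_raise_aux:
  assumes "(x, y) \<in> joined m"
  shows "\<forall>v\<in>alive_at x. \<forall>w\<in>alive_at y.
    (x \<otimes>\<^bsub>A\<^esub> letter (up x v), y \<otimes>\<^bsub>A\<^esub> letter (up y w)) \<in> joined (m + \<eta> / 4)"
  using assms unfolding joined_def[of m]
proof (induction rule: rtrancl_on_induct)
  case base
  then show ?case using joined_up by blast
next
  case (step y z)
  then obtain v b where z: "z = y \<otimes>\<^bsub>A\<^esub> letter (v, b)" "v \<in> V" by (auto simp: cay_def)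
  have yz: "y \<in> carrier A" "m \<le> pot y" "z \<in> carrier A" "m \<le> pot z" using step.hyps by auto
  obtain u w where uw: "u \<in> alive_at y" "w \<in> alive_at z"
    "(y \<otimes>\<^bsub>A\<^esub> letter (up y u), z \<otimes>\<^bsub>A\<^esub> letter (up z w)) \<in> joined (m + \<eta> / 4)"
    using joined_up_step[OF yz(1,2) z(2,1) yz(4)] by blast
  show ?case
  proof (intro ballI)
    fix v' w' assume v': "v' \<in> alive_at x" and w': "w' \<in> alive_at z"
    have "(x \<otimes>\<^bsub>A\<^esub> letter (up x v'), y \<otimes>\<^bsub>A\<^esub> letter (up y u)) \<in> joined (m + \<eta> / 4)"
      using step.IH v' uw(1) by blast
    moreover have "(z \<otimes>\<^bsub>A\<^esub> letter (up z w), z \<otimes>\<^bsub>A\<^esub> letter (up z w')) \<in> joined (m + \<eta> / 4)"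
      by (rule joined_up[OF yz(3,4) uw(2) w'])
    ultimately show "(x \<otimes>\<^bsub>A\<^esub> letter (up x v'), z \<otimes>\<^bsub>A\<^esub> letter (up z w')) \<in> joined (m + \<eta> / 4)"
      using uw(3) joined_trans by blast
  qed
qed

lemma joined_raise:
  assumes xy: "(x, y) \<in> joined m" and "m + \<eta> / 4 \<le> pot x" "m + \<eta> / 4 \<le> pot y"
  shows "(x, y) \<in> joined (m + \<eta> / 4)"
proof -
  have A: "x \<in> carrier A" "y \<in> carrier A"
    using in_rtrancl_on_in_F[OF xy[unfolded joined_def]] by auto
  obtain v w where vw: "v \<in> alive_at x" "w \<in> alive_at y" using alive_at_nonempty by meson
  have "(x, x \<otimes>\<^bsub>A\<^esub> letter (up x v)) \<in> joined (m + \<eta> / 4)"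
    "(y, y \<otimes>\<^bsub>A\<^esub> letter (up y w)) \<in> joined (m + \<eta> / 4)"
    using joined_self_up A assms vw by blast+
  then show ?thesis using joined_raise_aux[OF xy] vw joined_trans joined_sym by blast
qed

lemma joined_raise_many:
  "(x, y) \<in> joined (N - real k * (\<eta> / 4)) \<Longrightarrow> N \<le> pot x \<Longrightarrow> N \<le> pot y \<Longrightarrow> (x, y) \<in> joined N"
proof (induction k)
  case (Suc k)
  let ?m = "N - real (Suc k) * (\<eta> / 4)"
  have m: "?m + \<eta> / 4 = N - real k * (\<eta> / 4)" by (simp add: algebra_simps)
  have "0 \<le> real k * (\<eta> / 4)" using \<eta>_pos by simp
  then have "?m + \<eta> / 4 \<le> pot x" "?m + \<eta> / 4 \<le> pot y" unfolding m using Suc.prems by linarith+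
  from joined_raise[OF Suc.prems(1) this] show ?case unfolding m by (rule Suc.IH[OF _ Suc.prems(2,3)])
qed simp

lemma joined_one: "x \<in> carrier A \<Longrightarrow> \<exists>m. (\<one>\<^bsub>A\<^esub>, x) \<in> joined m"
proof (induction x rule: A_induct)
  case one
  have "(\<one>\<^bsub>A\<^esub>, \<one>\<^bsub>A\<^esub>) \<in> joined (pot \<one>\<^bsub>A\<^esub>)"
    unfolding joined_def by (intro rtrancl_on_refl) simp
  then show ?case by blast
next
  case (step a l)
  then obtain m where m: "(\<one>\<^bsub>A\<^esub>, a) \<in> joined m" by blast
  let ?m = "min m (min (pot a) (pot (a \<otimes>\<^bsub>A\<^esub> letter l)))"
  have "(a, a \<otimes>\<^bsub>A\<^esub> letter l) \<in> joined ?m"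
    using step.hyps by (intro joined_letter) simp_all
  moreover have "(\<one>\<^bsub>A\<^esub>, a) \<in> joined ?m" by (rule joined_mono[OF m]) simp
  ultimately show ?case using joined_trans by blast
qed

text \<open>Some path exists at a possibly very low level; as each push gains the fixed amount
  \<eta> / 4, finitely many of them reach \<open>N\<close>.\<close>

lemma joined_all:
  assumes "x \<in> carrier A" "y \<in> carrier A" "N \<le> pot x" "N \<le> pot y"
  shows "(x, y) \<in> joined N"
proof -
  obtain m1 m2 where "(\<one>\<^bsub>A\<^esub>, x) \<in> joined m1" "(\<one>\<^bsub>A\<^esub>, y) \<in> joined m2"
    using joined_one assms by meson
  then have "(\<one>\<^bsub>A\<^esub>, x) \<in> joined (min m1 m2)" "(\<one>\<^bsub>A\<^esub>, y) \<in> joined (min m1 m2)"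
    by (auto elim!: joined_mono)
  then have xy: "(x, y) \<in> joined (min m1 m2)" using joined_trans joined_sym by blast
  obtain k where k: "(N - min m1 m2) / (\<eta> / 4) \<le> real k" using real_arch_simple by blast
  have "0 < \<eta> / 4" using \<eta>_pos by simp
  from k[unfolded pos_divide_le_eq[OF this]] have "N - real k * (\<eta> / 4) \<le> min m1 m2" by linarith
  from joined_mono[OF xy this] show ?thesis using joined_raise_many assms by blast
qed

section \<open>Projecting paths to the half-space\<close>

definition half :: "'v word set set" where
  "half = {g \<in> carrier BB. 0 \<le> chr f g}"

definition linked :: "'v word set rel" where
  "linked = rtrancl_on half ((parcs (cayley_graph BB edges))\<^sup>s)"

lemma linked_sym: "(x, y) \<in> linked \<Longrightarrow> (y, x) \<in> linked"
  unfolding linked_def by (rule rtrancl_on_sym'[OF sym_symcl])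

lemma linked_trans: "(x, y) \<in> linked \<Longrightarrow> (y, z) \<in> linked \<Longrightarrow> (x, z) \<in> linked"
  unfolding linked_def by (rule rtrancl_on_trans)

lemma linked_edge:
  assumes "g \<in> half" "e \<in> edges" "g \<otimes>\<^bsub>A\<^esub> e \<in> half"
  shows "(g, g \<otimes>\<^bsub>A\<^esub> e) \<in> linked"
  unfolding linked_def
proof (rule rtrancl_on_arc)
  have "(g, g \<otimes>\<^bsub>A\<^esub> e) \<in> parcs (cayley_graph BB edges)"
    using assms unfolding cayley_graph_def half_def by auto
  then show "(g, g \<otimes>\<^bsub>A\<^esub> e) \<in> (parcs (cayley_graph BB edges))\<^sup>s" by (simp add: symcl_def)
qed (use assms in simp_all)

lemma pow_in_BB: "e \<in> carrier BB \<Longrightarrow> e [^]\<^bsub>A\<^esub> (n::nat) \<in> carrier BB"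
proof (induction n)
  case 0
  then show ?case using BB.one_closed by simp
next
  case (Suc n)
  then show ?case using BB.m_closed[OF Suc.IH Suc.prems] by simp
qed

text \<open>The character is affine along powers of \<open>e\<close>, so it is nonnegative at all
  intermediate powers when it is so at both ends.\<close>

lemma linked_pow:
  assumes g: "g \<in> half" and e: "e \<in> edges"
  shows "g \<otimes>\<^bsub>A\<^esub> e [^]\<^bsub>A\<^esub> (n::nat) \<in> half \<Longrightarrow> (g, g \<otimes>\<^bsub>A\<^esub> e [^]\<^bsub>A\<^esub> n) \<in> linked"
proof (induction n)
  case 0
  then show ?case using g BB_in_A by (simp add: linked_def half_def)
next
  case (Suc n)
  have gBB: "g \<in> carrier BB" and g0: "0 \<le> chr f g" using g by (auto simp: half_def)
  have eBB: "e \<in> carrier BB" using e edges_subset by blast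
  note A = BB_in_A[OF gBB] BB_in_A[OF eBB]
  have pow: "e [^]\<^bsub>A\<^esub> n \<in> carrier BB" by (rule pow_in_BB[OF eBB])
  have c: "chr f (g \<otimes>\<^bsub>A\<^esub> e [^]\<^bsub>A\<^esub> k) = chr f g + real k * chr f e" for k :: nat
    using A by (simp add: chr_mult chr_pow)
  have "0 \<le> chr f (g \<otimes>\<^bsub>A\<^esub> e [^]\<^bsub>A\<^esub> Suc n)"
    using Suc.prems by (simp only: half_def mem_Collect_eq)
  then have "0 \<le> chr f g + real (Suc n) * chr f e" unfolding c .
  then have "0 \<le> chr f g + real n * chr f e"
  proof (cases "0 \<le> chr f e")
    case True
    then have "0 \<le> real n * chr f e" by simp
    with g0 show ?thesis by linarith
  next
    case False
    have "real (Suc n) * chr f e = real n * chr f e + chr f e" by (simp add: distrib_right)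
    with False \<open>0 \<le> chr f g + real (Suc n) * chr f e\<close> show ?thesis by linarith
  qed
  then have h: "g \<otimes>\<^bsub>A\<^esub> e [^]\<^bsub>A\<^esub> n \<in> half"
    using BB.m_closed[OF gBB pow] unfolding half_def by (simp add: c)
  have eq: "g \<otimes>\<^bsub>A\<^esub> e [^]\<^bsub>A\<^esub> Suc n = g \<otimes>\<^bsub>A\<^esub> e [^]\<^bsub>A\<^esub> n \<otimes>\<^bsub>A\<^esub> e"
    using A by (simp add: A.m_assoc)
  have "(g \<otimes>\<^bsub>A\<^esub> e [^]\<^bsub>A\<^esub> n, g \<otimes>\<^bsub>A\<^esub> e [^]\<^bsub>A\<^esub> Suc n) \<in> linked"
    unfolding eq using h e Suc.prems[unfolded eq] by (rule linked_edge)
  with Suc.IH[OF h] show ?case using linked_trans by blast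
qed

lemma linked_int_pow:
  fixes n :: int
  assumes g: "g \<in> half" and e: "e \<in> edges" and ge: "g \<otimes>\<^bsub>A\<^esub> e [^]\<^bsub>A\<^esub> n \<in> half"
  shows "(g, g \<otimes>\<^bsub>A\<^esub> e [^]\<^bsub>A\<^esub> n) \<in> linked"
proof (cases n rule: int_cases2)
  case (nonneg k)
  with ge linked_pow[OF g e, of k] show ?thesis by (simp only: int_pow_int)
next
  case (nonpos k)
  have A: "g \<in> carrier A" "e \<in> carrier A"
    using g e edges_subset BB_in_A by (auto simp: half_def)
  let ?h = "g \<otimes>\<^bsub>A\<^esub> e [^]\<^bsub>A\<^esub> n"
  have n: "e [^]\<^bsub>A\<^esub> n = inv\<^bsub>A\<^esub> (e [^]\<^bsub>A\<^esub> k)"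
    using nonpos A by (simp only: A.int_pow_neg_int)
  have "?h \<otimes>\<^bsub>A\<^esub> e [^]\<^bsub>A\<^esub> k = g \<otimes>\<^bsub>A\<^esub> (inv\<^bsub>A\<^esub> (e [^]\<^bsub>A\<^esub> k) \<otimes>\<^bsub>A\<^esub> e [^]\<^bsub>A\<^esub> k)"
    unfolding n using A by (simp only: A.m_assoc A.inv_closed A.nat_pow_closed)
  also have "\<dots> = g" using A by simp
  finally have hg: "?h \<otimes>\<^bsub>A\<^esub> e [^]\<^bsub>A\<^esub> k = g" .
  have "(?h, ?h \<otimes>\<^bsub>A\<^esub> e [^]\<^bsub>A\<^esub> k) \<in> linked"
    by (rule linked_pow[OF ge e]) (simp only: hg g)
  then show ?thesis unfolding hg by (rule linked_sym)
qed

text \<open>With \<open>M\<close> the maximum of \<open>\<bar>f v\<bar>\<close>, this is the maximum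
  of \<open>M * t - \<kappa> * t\<^sup>2\<close>: projecting from height \<open>H\<close> costs at
  most \<open>M * \<bar>H\<bar>\<close>, while \<open>pot\<close> has already subtracted
  \<open>\<kappa> * H\<^sup>2\<close>.\<close>

definition bound :: real where
  "bound = (Max ((\<lambda>v. \<bar>f v\<bar>) ` V))\<^sup>2 / (4 * \<kappa>)"

lemma proj_in_half:
  assumes "x \<in> carrier A" "bound \<le> pot x" "u \<in> V"
  shows "proj x u \<in> half"
proof -
  define M where "M = Max ((\<lambda>v. \<bar>f v\<bar>) ` V)"
  have M: "\<bar>f u\<bar> \<le> M" unfolding M_def using finite_V assms(3) by (intro Max_ge) auto
  let ?h = "\<bar>real_of_int (H x)\<bar>"
  have \<kappa>: "0 < \<kappa>" using \<eta>_pos by (simp add: \<kappa>_def)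
  have "0 \<le> \<kappa> * (?h - M / (2 * \<kappa>))\<^sup>2" using \<kappa> by simp
  also have "\<dots> = \<kappa> * ?h\<^sup>2 - ?h * M + M\<^sup>2 / (4 * \<kappa>)"
    using \<kappa> by (simp add: power2_eq_square field_simps)
  also have "\<dots> \<le> chr f x - ?h * M"
    using assms(2) by (simp add: bound_def pot_def M_def)
  also have "\<dots> \<le> chr f x - H x * f u"
  proof -
    have "H x * f u \<le> \<bar>H x * f u\<bar>" by simp
    also have "\<dots> \<le> ?h * M" unfolding abs_mult using M by (simp add: mult_left_mono)
    finally show ?thesis by simp
  qed
  also have "\<dots> = chr f (proj x u)" by (rule chr_proj[OF assms(1,3), symmetric])
  finally show ?thesis using proj_in_BB[OF assms(1,3)] by (simp add: half_def)
qed

lemma linked_proj: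
  assumes x: "x \<in> carrier A" "bound \<le> pot x" and uv: "u \<in> V" "v \<in> V"
  shows "(proj x u, proj x v) \<in> linked"
  using rtrancl_V[OF uv]
proof (induction rule: rtrancl_on_induct)
  case base
  then show ?case using proj_in_half[OF x] by (simp add: linked_def)
next
  case (step y z)
  have "edge z y \<in> edges" using arc_sym[OF step.hyps(2)] by (auto simp: edges_def)
  moreover have "proj x z = proj x y \<otimes>\<^bsub>A\<^esub> edge z y [^]\<^bsub>A\<^esub> H x"
    by (rule proj_adjacent[OF x(1) step.hyps(2)])
  ultimately have "(proj x y, proj x z) \<in> linked"
    using linked_int_pow[OF proj_in_half[OF x step.hyps(3)], of "edge z y" "H x"]
      proj_in_half[OF x step.hyps(4)] by (simp only:)
  with step.IH show ?case using linked_trans by blast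
qed

text \<open>An arc with letter \<open>v\<close> is invisible to the projection along
  \<open>v\<close>: the path changes from \<open>u\<close> to \<open>v\<close> at one end and back
  to \<open>u\<close> at the other.\<close>

lemma linked_of_joined:
  assumes "(x, y) \<in> joined bound" "u \<in> V"
  shows "(proj x u, proj y u) \<in> linked"
  using assms(1) unfolding joined_def
proof (induction rule: rtrancl_on_induct)
  case base
  then show ?case using linked_proj assms(2) by blast
next
  case (step y z)
  then obtain v b where z: "z = y \<otimes>\<^bsub>A\<^esub> letter (v, b)" "v \<in> V" by (auto simp: cay_def)
  have yz: "y \<in> carrier A" "bound \<le> pot y" "z \<in> carrier A" "bound \<le> pot z" using step.hyps by auto
  have "(proj y u, proj y v) \<in> linked" by (rule linked_proj[OF yz(1,2) assms(2) z(2)])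
  moreover have "proj y v = proj z v" using proj_mult_letter[OF yz(1) z(2)] z(1) by simp
  moreover have "(proj z v, proj z u) \<in> linked" by (rule linked_proj[OF yz(3,4) z(2) assms(2)])
  ultimately have "(proj y u, proj z u) \<in> linked" using linked_trans by simp
  with step.IH show ?case using linked_trans by blast
qed

lemma ascending_edge: "\<exists>e\<in>edges. 0 < chr f e"
proof (rule ccontr)
  assume *: "\<not> ?thesis"
  have "f v = f w" if "(v, w) \<in> E" for v w
  proof -
    have "edge v w \<in> edges" "edge w v \<in> edges" using that arc_sym by (auto simp: edges_def)
    then have "chr f (edge v w) \<le> 0" "chr f (edge w v) \<le> 0" using * by fastforce+
    then show ?thesis using arc_in_V[OF that] by (simp add: chr_edge)
  qed
  note const = this
  have "f v = f w" if "(v, w) \<in> rtrancl_on V E" for v w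
    using that
  proof (induction rule: rtrancl_on_induct)
    case (step y z)
    then show ?case using const[OF step.hyps(2)] by simp
  qed simp
  then show False using nonconst rtrancl_V by blast
qed

text \<open>Following powers of an ascending edge leads high enough for \<open>joined_all\<close>,
  because \<open>pot\<close> and \<open>chr f\<close> agree at height 0.\<close>

lemma linked_above:
  assumes "g \<in> half"
  obtains h where "(g, h) \<in> linked" "h \<in> carrier BB" "bound \<le> chr f h"
proof -
  obtain e where e: "e \<in> edges" "0 < chr f e" using ascending_edge by blast
  have A: "g \<in> carrier A" "e \<in> carrier A" and BB: "g \<in> carrier BB" "e \<in> carrier BB"
    using assms e edges_subset BB_in_A by (auto simp: half_def)
  obtain n where "bound / chr f e \<le> real n" using real_arch_simple by blast
  then have n: "bound \<le> real n * chr f e" using e(2) by (simp add: pos_divide_le_eq)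
  have c: "chr f (g \<otimes>\<^bsub>A\<^esub> e [^]\<^bsub>A\<^esub> n) = chr f g + real n * chr f e"
    using A by (simp add: chr_mult chr_pow)
  have "e [^]\<^bsub>A\<^esub> n \<in> carrier BB" by (rule pow_in_BB[OF BB(2)])
  then have "g \<otimes>\<^bsub>A\<^esub> e [^]\<^bsub>A\<^esub> n \<in> carrier BB" using BB.m_closed[OF BB(1)] by simp
  moreover have "0 \<le> chr f g" using assms by (simp add: half_def)
  moreover have "0 \<le> real n * chr f e" using e(2) by simp
  ultimately have "g \<otimes>\<^bsub>A\<^esub> e [^]\<^bsub>A\<^esub> n \<in> half" "bound \<le> chr f (g \<otimes>\<^bsub>A\<^esub> e [^]\<^bsub>A\<^esub> n)"
    using n unfolding half_def mem_Collect_eq c by linarith+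
  then show thesis using that linked_pow[OF assms e(1)] by (auto simp: half_def)
qed

lemma conn_half: "conn_on half ((parcs (cayley_graph BB edges))\<^sup>s)"
proof -
  have "(g, g') \<in> linked" if gg: "g \<in> half" "g' \<in> half" for g g'
  proof -
    obtain h where h: "(g, h) \<in> linked" "h \<in> carrier BB" "bound \<le> chr f h"
      using linked_above[OF gg(1)] .
    obtain h' where h': "(g', h') \<in> linked" "h' \<in> carrier BB" "bound \<le> chr f h'"
      using linked_above[OF gg(2)] .
    obtain u where u: "u \<in> V" using nonconst by blast
    have "pot h = chr f h" "pot h' = chr f h'"
      using h(2) h'(2) by (simp_all add: pot_def carrier_BB)
    then have "(h, h') \<in> joined bound"
      using h h' by (intro joined_all BB_in_A) simp_all
    from linked_of_joined[OF this u] have "(h, h') \<in> linked"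
      using proj_BB h(2) h'(2) u by simp
    then show ?thesis using h(1) linked_sym[OF h'(1)] linked_trans by blast
  qed
  moreover have "\<one>\<^bsub>A\<^esub> \<in> half"
    using BB.one_closed by (simp add: half_def chr_one)
  ultimately show ?thesis unfolding conn_on_def linked_def by blast
qed

end

context connected_simple_graph
begin

lemma in_BNS:
  assumes nz: "res f \<noteq> (\<lambda>_. 0)"
    and no_sep: "\<And>U. sepset U \<Longrightarrow> \<exists>u\<in>U. \<exists>v\<in>U. f u \<noteq> f v"
  shows "char_class (res f) \<in> BNS BB"
proof -
  let ?D = "(\<lambda>(v, w). \<bar>f v - f w\<bar>) ` {(v, w) \<in> V \<times> V. f v \<noteq> f w}"
  have "finite {(v, w) \<in> V \<times> V. f v \<noteq> f w}"
    by (rule finite_subset[of _ "V \<times> V"]) (use finite_V in auto)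
  then have fin: "finite ?D" by (rule finite_imageI)
  have nonconst: "\<exists>v\<in>V. \<exists>w\<in>V. f v \<noteq> f w"
    using nz unfolding res_eq_0_iff by blast
  then have ne: "?D \<noteq> {}" by auto
  interpret no_level_separation \<Gamma> f "Min ?D / 2"
  proof unfold_locales
    show "0 < Min ?D / 2" using Min_in[OF fin ne] by auto
    show "2 * (Min ?D / 2) \<le> \<bar>f v - f w\<bar>" if "v \<in> V" "w \<in> V" "f v \<noteq> f w" for v w
    proof -
      have "Min ?D \<le> \<bar>f v - f w\<bar>" by (rule Min_le[OF fin]) (use that in auto)
      then show ?thesis by simp
    qed
  qed (fact nonconst no_sep)+
  have half: "{g \<in> carrier BB. res f g \<ge> 0} = half"
    by (auto simp: half_def res_def)
  have "res f \<in> characters BB - {\<lambda>_. 0}" using nz res_character by blast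
  from char_class_in_BNS_iff[OF this] show ?thesis
    using conn_half finite_generating_edges unfolding half by blast
qed

end


section \<open>Missing subspheres\<close>

lemma char_subspace_zero: "char_subspace G W \<Longrightarrow> (\<lambda>_. 0) \<in> W"
  and char_subspace_add: "char_subspace G W \<Longrightarrow> \<phi> \<in> W \<Longrightarrow> \<psi> \<in> W \<Longrightarrow> (\<lambda>g. \<phi> g + \<psi> g) \<in> W"
  and char_subspace_scale: "char_subspace G W \<Longrightarrow> \<phi> \<in> W \<Longrightarrow> (\<lambda>g. c * \<phi> g) \<in> W"
  by (simp_all add: char_subspace_def)

lemma char_class_in_sphere_iff:
  assumes W: "char_subspace G W" and nz: "\<phi> \<noteq> (\<lambda>_. 0)"
  shows "char_class \<phi> \<in> sphere_of W \<longleftrightarrow> \<phi> \<in> W"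
proof
  assume "char_class \<phi> \<in> sphere_of W"
  then obtain \<psi> where \<psi>: "\<psi> \<in> W" "char_class \<psi> = char_class \<phi>" by (auto simp: sphere_of_def)
  obtain c where "\<phi> = (\<lambda>g. c * \<psi> g)" by (rule char_class_eqD[OF \<psi>(2)])
  then show "\<phi> \<in> W" using char_subspace_scale[OF W \<psi>(1)] by simp
qed (use nz in \<open>auto simp: sphere_of_def\<close>)

text \<open>Subspaces are closed under scaling, so a nonzero character can be recovered from its
  class.\<close>

lemma sphere_subset_imp:
  assumes W: "char_subspace G W" and W': "char_subspace G W'" and "sphere_of W \<subseteq> sphere_of W'"
  shows "W \<subseteq> W'"
proof
  fix \<phi> assume \<phi>: "\<phi> \<in> W"
  show "\<phi> \<in> W'"
  proof (cases "\<phi> = (\<lambda>_. 0)")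
    case True
    then show ?thesis using char_subspace_zero[OF W'] by simp
  next
    case False
    with \<phi> assms show ?thesis using char_class_in_sphere_iff by blast
  qed
qed

text \<open>The topological hypothesis is represented by its combinatorial consequence
  \<open>min_sepset_conn\<close>; what follows is linear algebra.\<close>

locale biconnected_graph = connected_simple_graph \<Gamma> for \<Gamma> :: "'v pair_pre_digraph" +
  assumes no_cut_vertex: "\<not> sepset {x}"
    and min_sepset_conn: "min_sepset U \<Longrightarrow> u \<in> U \<Longrightarrow> v \<in> U \<Longrightarrow> (u, v) \<in> rtrancl_on U E"
begin

abbreviation W_full :: "'v set \<Rightarrow> ('v word set \<Rightarrow> real) set" where
  "W_full U \<equiv> W_sub \<Gamma> (full \<Gamma> U)"

lemma const_of_arcs:
  assumes "(u, v) \<in> rtrancl_on U E" and "\<And>v w. (v, w) \<in> E \<Longrightarrow> v \<in> U \<Longrightarrow> w \<in> U \<Longrightarrow> f v = (f w :: real)"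
  shows "f u = f v"
  using assms(1)
proof (induction rule: rtrancl_on_induct)
  case (step y z)
  then show ?case using assms(2)[OF step.hyps(2,3,4)] by simp
qed simp

lemma res_arc: "(v, w) \<in> E \<Longrightarrow> res f (bb_edge \<Gamma> (v, w)) = f w - f v"
  using arc_in_V[of v w] res_edge[of v w f] by blast

text \<open>The condition on edges makes \<open>f\<close> constant along arcs inside
  \<open>U\<close>, and connectedness of \<open>U\<close> spreads this to all of
  \<open>U\<close>.\<close>

lemma res_in_W_full_iff:
  assumes U: "min_sepset U"
  shows "res f \<in> W_full U \<longleftrightarrow> (\<forall>u\<in>U. \<forall>v\<in>U. f u = f v)"
proof
  assume "res f \<in> W_full U"
  then have *: "res f (bb_edge \<Gamma> e) = 0" if "e \<in> E \<inter> U \<times> U" for e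
    using that by (auto simp: W_sub_def)
  have arcs: "f v = f w" if "(v, w) \<in> E" "v \<in> U" "w \<in> U" for v w
  proof -
    have "res f (bb_edge \<Gamma> (v, w)) = 0" using *[of "(v, w)"] that by blast
    then show ?thesis using res_arc[OF that(1), of f] by linarith
  qed
  show "\<forall>u\<in>U. \<forall>v\<in>U. f u = f v"
  proof (intro ballI)
    fix u v assume "u \<in> U" "v \<in> U"
    from min_sepset_conn[OF U this] show "f u = f v" by (rule const_of_arcs) (rule arcs)
  qed
next
  assume *: "\<forall>u\<in>U. \<forall>v\<in>U. f u = f v"
  have "res f (bb_edge \<Gamma> (v, w)) = 0" if "(v, w) \<in> E" "v \<in> U" "w \<in> U" for v w
  proof -
    have "f v = f w" using * that(2,3) by blast
    then show ?thesis using res_arc[OF that(1), of f] by linarith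
  qed
  then show "res f \<in> W_full U"
    using res_character by (auto simp: W_sub_def)
qed

lemma characters_lin:
  assumes "\<phi> \<in> characters BB" "\<psi> \<in> characters BB"
  shows "(\<lambda>g. r * \<phi> g + s * \<psi> g) \<in> characters BB"
proof -
  obtain f where f: "\<phi> = res f" by (rule character_eq_res[OF assms(1)])
  obtain g where g: "\<psi> = res g" by (rule character_eq_res[OF assms(2)])
  show ?thesis
    using res_character[of "\<lambda>v. r * f v + s * g v"] unfolding res_lin f g .
qed

lemma subspace_W_full: "char_subspace BB (W_full U)"
  unfolding char_subspace_def
proof (intro conjI ballI allI)
  show "W_full U \<subseteq> characters BB" by (auto simp: W_sub_def)
  show "(\<lambda>_. 0) \<in> W_full U"
    using characters_lin[OF res_character res_character, of 0 _ 0] by (simp add: W_sub_def)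
  show "(\<lambda>g. \<phi> g + \<psi> g) \<in> W_full U" if "\<phi> \<in> W_full U" "\<psi> \<in> W_full U" for \<phi> \<psi>
    using that characters_lin[of \<phi> \<psi> 1 1] by (simp add: W_sub_def)
  show "(\<lambda>g. c * \<phi> g) \<in> W_full U" if "\<phi> \<in> W_full U" for c \<phi>
    using that characters_lin[of \<phi> \<phi> c 0] by (simp add: W_sub_def)
qed

text \<open>Constancy on a separating set passes to a minimal one inside it, so the two criteria for
  vertex functions meet in the spaces \<open>W_full U\<close>.\<close>

lemma BNS_compl_iff:
  assumes "\<phi> \<in> characters BB" "\<phi> \<noteq> (\<lambda>_. 0)"
  shows "char_class \<phi> \<in> BNS_compl BB \<longleftrightarrow> (\<exists>U. min_sepset U \<and> \<phi> \<in> W_full U)"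
proof -
  obtain f where f: "\<phi> = res f" using character_eq_res[OF assms(1)] .
  have "char_class \<phi> \<in> character_sphere BB"
    using assms by (auto simp: character_sphere_def sphere_of_def)
  then have "char_class \<phi> \<in> BNS_compl BB \<longleftrightarrow> char_class \<phi> \<notin> BNS BB"
    by (simp add: BNS_compl_def)
  also have "\<dots> \<longleftrightarrow> (\<exists>U. min_sepset U \<and> \<phi> \<in> W_full U)"
  proof
    assume "char_class \<phi> \<notin> BNS BB"
    then obtain U where U: "sepset U" "\<forall>u\<in>U. \<forall>v\<in>U. f u = f v"
      using in_BNS[of f] assms(2) unfolding f by blast
    obtain U' where "U' \<subseteq> U" "min_sepset U'" using sepset_imp_min_sepset[OF U(1)] .
    with U(2) show "\<exists>U. min_sepset U \<and> \<phi> \<in> W_full U"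
      unfolding f using res_in_W_full_iff by blast
  next
    assume "\<exists>U. min_sepset U \<and> \<phi> \<in> W_full U"
    then obtain U where U: "min_sepset U" "\<forall>u\<in>U. \<forall>v\<in>U. f u = f v"
      unfolding f using res_in_W_full_iff by blast
    have "sepset U" using U(1) by (simp add: min_sepset_def)
    then show "char_class \<phi> \<notin> BNS BB"
      using not_in_BNS[of U f] U(2) assms(2) unfolding f by blast
  qed
  finally show ?thesis .
qed

lemma sphere_of_W_full: "S_sub \<Gamma> (full \<Gamma> U) = sphere_of (W_full U)"
  by (simp add: S_sub_def)

lemma BNS_compl_eq: "BNS_compl BB = (\<Union>U\<in>{U. min_sepset U}. sphere_of (W_full U))"
proof (intro equalityI subsetI)
  fix t assume t: "t \<in> BNS_compl BB"
  then obtain \<phi> where \<phi>: "\<phi> \<in> characters BB" "\<phi> \<noteq> (\<lambda>_. 0)" "t = char_class \<phi>"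
    by (auto simp: BNS_compl_def character_sphere_def sphere_of_def)
  with t obtain U where "min_sepset U" "\<phi> \<in> W_full U" using BNS_compl_iff by blast
  with \<phi> show "t \<in> (\<Union>U\<in>{U. min_sepset U}. sphere_of (W_full U))"
    by (auto simp: sphere_of_def)
next
  fix t assume "t \<in> (\<Union>U\<in>{U. min_sepset U}. sphere_of (W_full U))"
  then obtain U \<phi> where *: "min_sepset U" "\<phi> \<in> W_full U" "\<phi> \<noteq> (\<lambda>_. 0)" "t = char_class \<phi>"
    by (auto simp: sphere_of_def)
  then have "\<phi> \<in> characters BB" by (simp add: W_sub_def)
  with * show "t \<in> BNS_compl BB" using BNS_compl_iff by blast
qed

section \<open>Subspaces inside the complement\<close>

definition support :: "('v word set \<Rightarrow> real) \<Rightarrow> ('v \<times> 'v) set" where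
  "support \<phi> = {e \<in> E. \<phi> (bb_edge \<Gamma> e) \<noteq> 0}"

lemma finite_support: "finite (support \<phi>)"
  using finite_E by (simp add: support_def)

lemma support_eq_empty:
  assumes "\<phi> \<in> characters BB" "support \<phi> = {}"
  shows "\<phi> = (\<lambda>_. 0)"
proof -
  obtain f where f: "\<phi> = res f" using character_eq_res[OF assms(1)] .
  have arcs: "f v = f w" if "(v, w) \<in> E" for v w
  proof -
    have "\<phi> (bb_edge \<Gamma> (v, w)) = 0" using that assms(2) unfolding support_def by blast
    then show ?thesis using res_arc[OF that, of f] unfolding f by simp
  qed
  have "f v = f w" if "v \<in> V" "w \<in> V" for v w
    using rtrancl_V[OF that] by (rule const_of_arcs) (rule arcs)
  then show ?thesis unfolding f res_eq_0_iff by blast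
qed

text \<open>A subspace contained in a finite union of the subspaces \<open>W_full U\<close> lies in one of them: take
  an element with the largest support.\<close>

lemma generic_element:
  assumes W: "char_subspace BB W"
  obtains \<phi> where "\<phi> \<in> W" "\<And>\<psi>. \<psi> \<in> W \<Longrightarrow> support \<psi> \<subseteq> support \<phi>"
proof -
  have le: "card (support \<psi>) \<le> card E" for \<psi>
    by (intro card_mono finite_E) (auto simp: support_def)
  have "\<exists>\<phi>. \<phi> \<in> W \<and> (\<forall>\<psi>. \<psi> \<in> W \<longrightarrow> card (support \<psi>) \<le> card (support \<phi>))"
    by (rule ex_has_greatest_nat[where k = "\<lambda>_. 0" and b = "Suc (card E)"])
      (use char_subspace_zero[OF W] le in \<open>simp_all add: less_Suc_eq_le\<close>)
  then obtain \<phi> where \<phi>: "\<phi> \<in> W" "\<And>\<psi>. \<psi> \<in> W \<Longrightarrow> card (support \<psi>) \<le> card (support \<phi>)"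
    by blast
  note \<phi>(1)
  moreover have "support \<psi> \<subseteq> support \<phi>" if \<psi>: "\<psi> \<in> W" for \<psi>
  proof (rule ccontr)
    assume "\<not> support \<psi> \<subseteq> support \<phi>"
    then obtain e0 where e0: "e0 \<in> support \<psi>" "e0 \<notin> support \<phi>" by blast
    let ?q = "\<lambda>e. - \<phi> (bb_edge \<Gamma> e) / \<psi> (bb_edge \<Gamma> e)"
    have "finite (insert 0 (?q ` support \<phi>))" using finite_support by simp
    \<comment> \<open>Avoiding the finitely many ratios prevents cancellation on
      \<open>support \<phi>\<close>, and avoiding 0 adds \<open>e0\<close>; the support of the
      combination would then be too large.\<close>
    then obtain c where c: "c \<notin> insert 0 (?q ` support \<phi>)"
      using ex_new_if_finite[OF infinite_UNIV_char_0] by blast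
    let ?\<chi> = "\<lambda>g. \<phi> g + c * \<psi> g"
    have "?\<chi> \<in> W" by (intro char_subspace_add[OF W] char_subspace_scale[OF W] \<phi>(1) \<psi>)
    have "insert e0 (support \<phi>) \<subseteq> support ?\<chi>"
    proof
      fix e assume e: "e \<in> insert e0 (support \<phi>)"
      show "e \<in> support ?\<chi>"
      proof (cases "e = e0")
        case True
        have "c \<noteq> 0" using c by blast
        then show ?thesis using e0 True by (simp add: support_def)
      next
        case False
        then have e': "e \<in> support \<phi>" using e by blast
        have "\<phi> (bb_edge \<Gamma> e) + c * \<psi> (bb_edge \<Gamma> e) \<noteq> 0"
        proof
          assume eq: "\<phi> (bb_edge \<Gamma> e) + c * \<psi> (bb_edge \<Gamma> e) = 0"
          have "\<phi> (bb_edge \<Gamma> e) \<noteq> 0" using e' by (simp add: support_def)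
          then have "\<psi> (bb_edge \<Gamma> e) \<noteq> 0" using eq by (metis add.right_neutral mult_zero_right)
          moreover have "c * \<psi> (bb_edge \<Gamma> e) = - \<phi> (bb_edge \<Gamma> e)" using eq by linarith
          ultimately have "c = ?q e" by (rule nonzero_eq_divide_eq[THEN iffD2])
          with c e' show False by blast
        qed
        then show ?thesis using e' by (simp add: support_def)
      qed
    qed
    then have "card (insert e0 (support \<phi>)) \<le> card (support ?\<chi>)"
      by (intro card_mono finite_support)
    also have "\<dots> \<le> card (support \<phi>)" by (rule \<phi>(2)[OF \<open>?\<chi> \<in> W\<close>])
    finally show False using e0(2) finite_support by simp
  qed
  ultimately show thesis by (rule that)
qed

text \<open>The generic element vanishes on the edges of some \<open>U\<close>. All other supports
  are contained in its support, so the whole of \<open>W\<close> vanishes there too.\<close>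

lemma missing_subspace:
  assumes W: "char_subspace BB W" and ne: "sphere_of W \<noteq> {}" and sub: "sphere_of W \<subseteq> BNS_compl BB"
  obtains U where "min_sepset U" "W \<subseteq> W_full U"
proof -
  obtain \<phi> where \<phi>: "\<phi> \<in> W" "\<And>\<psi>. \<psi> \<in> W \<Longrightarrow> support \<psi> \<subseteq> support \<phi>"
    using generic_element[OF W] by blast
  have Wch: "\<psi> \<in> characters BB" if "\<psi> \<in> W" for \<psi> using W that by (auto simp: char_subspace_def)
  obtain \<psi> where \<psi>: "\<psi> \<in> W" "\<psi> \<noteq> (\<lambda>_. 0)" using ne by (auto simp: sphere_of_def)
  then have "support \<psi> \<noteq> {}" using support_eq_empty Wch by blast
  with \<phi>(2)[OF \<psi>(1)] have "support \<phi> \<noteq> {}" by blast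
  then have nz: "\<phi> \<noteq> (\<lambda>_. 0)" by (auto simp: support_def)
  then have "char_class \<phi> \<in> BNS_compl BB" using \<phi>(1) sub by (auto simp: sphere_of_def)
  then obtain U where U: "min_sepset U" "\<phi> \<in> W_full U"
    using BNS_compl_iff[OF Wch[OF \<phi>(1)] nz] by blast
  have "W \<subseteq> W_full U"
  proof
    fix \<psi> assume \<psi>: "\<psi> \<in> W"
    have "\<psi> (bb_edge \<Gamma> e) = 0" if "e \<in> E \<inter> U \<times> U" for e
    proof -
      have "e \<notin> support \<phi>" using U(2) that unfolding W_sub_def support_def full_simps by blast
      then show ?thesis using \<phi>(2)[OF \<psi>] that unfolding support_def by blast
    qed
    then show "\<psi> \<in> W_full U" using Wch[OF \<psi>] by (simp add: W_sub_def)
  qed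
  with U(1) that show thesis by blast
qed

definition ind :: "'v \<Rightarrow> 'v \<Rightarrow> real" where
  "ind x v = (if v = x then 1 else 0)"

text \<open>The indicator of a vertex of \<open>U'\<close> outside \<open>U\<close> is constant on
  \<open>U\<close>, hence also on \<open>U'\<close>, which would make \<open>U'\<close> a cut
  vertex. So \<open>U'\<close> lies in \<open>U\<close>, and minimality of \<open>U\<close> gives
  equality.\<close>

lemma W_full_mono_imp_eq:
  assumes U: "min_sepset U" and U': "min_sepset U'" and sub: "W_full U \<subseteq> W_full U'"
  shows "U = U'"
proof -
  have "U' \<subseteq> U"
  proof
    fix x assume x: "x \<in> U'"
    show "x \<in> U"
    proof (rule ccontr)
      assume xU: "x \<notin> U"
      have "\<forall>u\<in>U. \<forall>v\<in>U. ind x u = ind x v" using xU by (auto simp: ind_def)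
      then have "res (ind x) \<in> W_full U'"
        using sub res_in_W_full_iff[OF U] by blast
      then have "\<forall>u\<in>U'. \<forall>v\<in>U'. ind x u = ind x v"
        using res_in_W_full_iff[OF U'] by blast
      then have "U' = {x}" using x by (force simp: ind_def split: if_splits)
      then show False using U' no_cut_vertex by (simp add: min_sepset_def)
    qed
  qed
  then show ?thesis using U U' by (auto simp: min_sepset_def)
qed

lemma sphere_of_W_full_nonempty:
  assumes U: "min_sepset U"
  shows "sphere_of (W_full U) \<noteq> {}"
proof -
  have sep: "sepset U" using U by (simp add: min_sepset_def)
  obtain u where u: "u \<in> U" using sepset_nonempty[OF sep] by blast
  obtain x where x: "x \<in> V" "x \<notin> U" using sepset_parts[OF sep] by blast
  have "\<forall>u\<in>U. \<forall>v\<in>U. ind x u = ind x v" using x by (auto simp: ind_def)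
  then have "res (ind x) \<in> W_full U" using res_in_W_full_iff[OF U] by blast
  moreover have "res (ind x) \<noteq> (\<lambda>_. 0)"
  proof
    assume "res (ind x) = (\<lambda>_. 0)"
    moreover have "u \<in> V" using u sep by (auto simp: sepset_def)
    ultimately have "ind x x = ind x u" using x unfolding res_eq_0_iff by blast
    then show False using u x by (auto simp: ind_def split: if_splits)
  qed
  ultimately show ?thesis by (auto simp: sphere_of_def)
qed

lemma missing_sphere_of_W_full:
  assumes U: "min_sepset U"
  shows "missing_subsphere BB (sphere_of (W_full U))"
  unfolding missing_subsphere_def
  using sphere_of_W_full_nonempty[OF U] subspace_W_full BNS_compl_eq U by blast

lemma missing_subsphere_contained:
  assumes "missing_subsphere BB T"
  obtains U where "min_sepset U" "T \<subseteq> sphere_of (W_full U)"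
proof -
  obtain W where W: "char_subspace BB W" "T = sphere_of W" "sphere_of W \<noteq> {}" "sphere_of W \<subseteq> BNS_compl BB"
    using assms unfolding missing_subsphere_def by blast
  obtain U where U: "min_sepset U" "W \<subseteq> W_full U" using missing_subspace[OF W(1,3,4)] .
  then have "T \<subseteq> sphere_of (W_full U)" unfolding W(2) sphere_of_def by blast
  with U(1) that show thesis by blast
qed

text \<open>Inclusion already forces equality, which yields both the maximality of these spheres and
  the injectivity of the correspondence.\<close>

lemma sphere_of_W_full_inj:
  assumes "min_sepset U" "min_sepset U'" "sphere_of (W_full U) \<subseteq> sphere_of (W_full U')"
  shows "U = U'"
  using assms W_full_mono_imp_eq sphere_subset_imp[OF subspace_W_full subspace_W_full] by blast

lemma maximal_missing_iff:
  "maximal_missing_subsphere BB T \<longleftrightarrow> (\<exists>U. min_sepset U \<and> T = sphere_of (W_full U))"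
proof
  assume T: "maximal_missing_subsphere BB T"
  then obtain U where U: "min_sepset U" "T \<subseteq> sphere_of (W_full U)"
    using missing_subsphere_contained unfolding maximal_missing_subsphere_def by blast
  then have "sphere_of (W_full U) = T"
    using T missing_sphere_of_W_full unfolding maximal_missing_subsphere_def by blast
  with U(1) show "\<exists>U. min_sepset U \<and> T = sphere_of (W_full U)" by blast
next
  assume "\<exists>U. min_sepset U \<and> T = sphere_of (W_full U)"
  then obtain U where U: "min_sepset U" and T: "T = sphere_of (W_full U)" by blast
  have "T' = T" if T': "missing_subsphere BB T'" "T \<subseteq> T'" for T'
  proof -
    obtain U' where U': "min_sepset U'" "T' \<subseteq> sphere_of (W_full U')"
      using missing_subsphere_contained[OF T'(1)] .
    then have "U = U'" using T T'(2) U by (intro sphere_of_W_full_inj) auto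
    with U'(2) T T'(2) show ?thesis by blast
  qed
  then show "maximal_missing_subsphere BB T"
    using missing_sphere_of_W_full[OF U] T unfolding maximal_missing_subsphere_def by blast
qed

theorem BNS_compl_and_maximal_missing:
  "BNS_compl BB = (\<Union>\<Lambda>\<in>{\<Lambda>. min_full_separating \<Gamma> \<Lambda>}. S_sub \<Gamma> \<Lambda>)
    \<and> bij_betw (S_sub \<Gamma>) {\<Lambda>. min_full_separating \<Gamma> \<Lambda>} {T. maximal_missing_subsphere BB T}"
proof
  have M: "{\<Lambda>. min_full_separating \<Gamma> \<Lambda>} = full \<Gamma> ` {U. min_sepset U}"
    unfolding min_full_separating_iff by blast
  show "BNS_compl BB = (\<Union>\<Lambda>\<in>{\<Lambda>. min_full_separating \<Gamma> \<Lambda>}. S_sub \<Gamma> \<Lambda>)"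
    unfolding M BNS_compl_eq by (simp add: sphere_of_W_full)
  show "bij_betw (S_sub \<Gamma>) {\<Lambda>. min_full_separating \<Gamma> \<Lambda>} {T. maximal_missing_subsphere BB T}"
    unfolding bij_betw_def M
  proof
    show "inj_on (S_sub \<Gamma>) (full \<Gamma> ` {U. min_sepset U})"
    proof (rule inj_onI)
      fix \<Lambda> \<Lambda>' assume *: "\<Lambda> \<in> full \<Gamma> ` {U. min_sepset U}" "\<Lambda>' \<in> full \<Gamma> ` {U. min_sepset U}"
        "S_sub \<Gamma> \<Lambda> = S_sub \<Gamma> \<Lambda>'"
      then obtain U U' where U: "min_sepset U" "min_sepset U'" "\<Lambda> = full \<Gamma> U" "\<Lambda>' = full \<Gamma> U'"
        by blast
      then have "U = U'" using *(3) by (intro sphere_of_W_full_inj) (simp_all add: sphere_of_W_full)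
      then show "\<Lambda> = \<Lambda>'" using U by simp
    qed
    show "S_sub \<Gamma> ` full \<Gamma> ` {U. min_sepset U} = {T. maximal_missing_subsphere BB T}"
      unfolding maximal_missing_iff image_image sphere_of_W_full by blast
  qed
qed

end

theorem theoremD:
  fixes \<Gamma> :: "'v::finite pair_pre_digraph"
  assumes "pair_graph \<Gamma>"
    and "Digraph_Component.connected (with_proj \<Gamma>)"
    and "biconnected \<Gamma>"
    and "simply_connected (geometric_realization (flag_complex \<Gamma>))"
  shows "BNS_compl (bestvina_brady \<Gamma>) = (\<Union>\<Lambda>\<in>{\<Lambda>. min_full_separating \<Gamma> \<Lambda>}. S_sub \<Gamma> \<Lambda>)
    \<and> bij_betw (S_sub \<Gamma>) {\<Lambda>. min_full_separating \<Gamma> \<Lambda>}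
        {T. maximal_missing_subsphere (bestvina_brady \<Gamma>) T}"
proof -
  interpret simple_graph \<Gamma> by (rule simple_graph.intro[OF assms(1)])
  \<comment> \<open>Restricting to all vertices changes nothing, so connectedness of \<Gamma> can be
    read through the criterion for induced subgraphs.\<close>
  have "{e \<in> E. fst e \<in> V \<and> snd e \<in> V} = E" using E_subset by auto
  then have "with_proj \<Gamma> \<restriction> V = with_proj \<Gamma>"
    by (simp add: induce_subgraph_def with_proj_def)
  then have conn: "conn_on V E"
    using assms(2) connected_induce_subgraph_iff[of \<Gamma> V] symcl_of_sym[OF sym_E] by simp
  have no_cut: "\<not> sepset {x}" for x
  proof
    assume x: "sepset {x}"
    then have "x \<in> V" by (simp add: sepset_def)
    moreover have "separating \<Gamma> \<lparr>pverts = {x}, parcs = {}\<rparr>"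
      using x \<open>x \<in> V\<close> E_subset by (simp add: separating_iff subgraph_iff)
    ultimately show False using assms(3) by (auto simp: biconnected_def cut_vertex_def)
  qed
  interpret biconnected_graph \<Gamma>
  proof unfold_locales
    show "(u, v) \<in> rtrancl_on U E" if "min_sepset U" "u \<in> U" "v \<in> U" for U u v
      by (rule min_sepset_rtrancl_on[OF simple_graph_axioms assms(4) that])
  qed (fact conn no_cut)+
  show ?thesis by (rule BNS_compl_and_maximal_missing)
qed

end
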